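(* Let $\mathcal K$ be a Köthe function space, let $Y$ be a Banach space, and let $\Omega:\mathcal K\to Y$ be a quasi-linear map. Consider the following assertions: (i) $\Omega$ is trivial; (ii) $\Omega$ is disjointly trivial; (iii) $\Omega$ is locally disjointly trivial; (iv) $\Omega$ is locally trivial. Then $(i)\Rightarrow(ii)\Rightarrow(iii)\Leftrightarrow(iv)$. Moreover, if $Y$ is complemented in its bidual, then all four assertions are equivalent.
   Context: Let $(\Sigma,\mu)$ be a $\sigma$-finite measure space and $L_0$ the space of all measurable scalar functions on it. A Köthe function space $\mathcal K$ is a linear subspace of $L_0$ endowed with a quasi-norm such that whenever $|f|\le g$ and $g\in\mathcal K$ then $f\in\mathcal K$ and $\|f\|\le\|g\|$, and such that $1_A\in\mathcal K$ for every $A\subset\Sigma$ of finite measure. A quasi-linear map $\Omega:X\to Y$ is a homogeneous map for which there is a constant $C$ with $\|\Omega(x_1+x_2)-\Omega x_1-\Omega x_2\|\le C(\|x_1\|+\|x_2\|)$ for all $x_1,x_2\in X$. For homogeneous maps $S,T$, $\|S-T\|$ denotes the supremum of $\|Sx-Tx\|$ over the unit ball. $\Omega$ is trivial if there is a linear (not necessarily continuous) map $L:X\to Y$ with $\|\Omega-L\|<\infty$. $\Omega$ is locally trivial if there is $C>0$ such that for every finite-dimensional subspace $F\subset X$ there is a linear map $L_F:F\to Y$ with $\|\Omega_{|F}-L_F\|\le C$. A quasi-linear map $\Omega:\mathcal K\to Y$ is disjointly trivial if its restriction to any subspace generated by (i.e. closed linear span of) a sequence of disjointly supported elements is trivial.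 It is locally disjointly trivial if there is $C>0$ such that for every finite-dimensional subspace $F$ of $\mathcal K$ generated by disjointly supported vectors there is a linear map $L_F:F\to Y$ with $\|\Omega_{|F}-L_F\|\le C$.
   Formalization: The lattice condition is taken as "whenever |f| ≤ |g| and g ∈ K then f ∈ K and ‖f‖ ≤ ‖g‖" (usual solidity); with "|f| ≤ g" read literally, so only for g ≥ 0, (iii)⇒(iv) fails, e.g. for L_∞(ℝ) plus odd polynomials with an ℓ_1 norm and Ribe's map. *)

theory Defs
  imports "HOL-Analysis.Analysis" "HOL-Library.Function_Algebras"
begin

text \<open>
  Scalars range over a type \<open>'k\<close> of sort \<open>{real_normed_field, euclidean_space}\<close>; the types
  \<open>real\<close> and \<open>complex\<close> have this sort, and by the theorem of Frobenius these are the only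
  examples up to isometric isomorphism.

  Elements of \<open>L\<^sub>0\<close> are classes of measurable functions modulo equality almost everywhere.  They are
  represented by functions, with pointwise operations.  Hence a quasi-norm vanishes exactly on the
  null functions, and a map defined on a space of classes is one that takes equal values on
  functions that agree almost everywhere.
\<close>

definition fscale :: "'k::field \<Rightarrow> ('a \<Rightarrow> 'k) \<Rightarrow> 'a \<Rightarrow> 'k" where
  "fscale c f = (\<lambda>x. c * f x)"

interpretation fvec: vector_space "fscale :: 'k::field \<Rightarrow> ('a \<Rightarrow> 'k) \<Rightarrow> 'a \<Rightarrow> 'k"
  by unfold_locales (auto simp: fscale_def fun_eq_iff algebra_simps)

definition linear_on ::
  "('k \<Rightarrow> 'v \<Rightarrow> 'v) \<Rightarrow> 'v set \<Rightarrow> ('k \<Rightarrow> 'w \<Rightarrow> 'w) \<Rightarrow> ('v::plus \<Rightarrow> 'w::plus) \<Rightarrow> bool" where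
  "linear_on sV V sW T \<longleftrightarrow>
     (\<forall>x\<in>V. \<forall>y\<in>V. T (x + y) = T x + T y) \<and> (\<forall>c. \<forall>x\<in>V. T (sV c x) = sW c (T x))"


section \<open>Banach spaces over the scalar field and complementation in the bidual\<close>

text \<open>The class \<open>banach\<close> only provides a real Banach space; \<open>sY\<close> is the multiplication by scalars
  in \<open>'k\<close>.\<close>

definition banach_over ::
  "('k::{real_normed_field, euclidean_space} \<Rightarrow> 'y::banach \<Rightarrow> 'y) \<Rightarrow> bool" where
  "banach_over sY \<longleftrightarrow> vector_space sY \<and>
     (\<forall>r y. sY (of_real r) y = r *\<^sub>R y) \<and> (\<forall>c y. norm (sY c y) = norm c * norm y)"

text \<open>The dual of a normed space with carrier \<open>V\<close> and norm \<open>N\<close>.  Functionals are set to \<open>0\<close>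
  outside \<open>V\<close>, so that each one is represented by exactly one function.\<close>

definition dual ::
  "('k::real_normed_field \<Rightarrow> 'v::plus \<Rightarrow> 'v) \<Rightarrow> 'v set \<Rightarrow> ('v \<Rightarrow> real) \<Rightarrow> ('v \<Rightarrow> 'k) set" where
  "dual sV V N = {\<phi>. linear_on sV V (*) \<phi> \<and> (\<exists>B. \<forall>v\<in>V. norm (\<phi> v) \<le> B * N v) \<and>
                     (\<forall>v. v \<notin> V \<longrightarrow> \<phi> v = 0)}"

definition dual_norm ::
  "'v set \<Rightarrow> ('v \<Rightarrow> real) \<Rightarrow> ('v \<Rightarrow> 'k::real_normed_field) \<Rightarrow> real" where
  "dual_norm V N \<phi> = (SUP v\<in>{v\<in>V. N v \<le> 1}. norm (\<phi> v))"

definition ydual ::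
  "('k::real_normed_field \<Rightarrow> 'y::real_normed_vector \<Rightarrow> 'y) \<Rightarrow> ('y \<Rightarrow> 'k) set" where
  "ydual sY = dual sY UNIV norm"

definition bidual ::
  "('k::real_normed_field \<Rightarrow> 'y::real_normed_vector \<Rightarrow> 'y) \<Rightarrow> (('y \<Rightarrow> 'k) \<Rightarrow> 'k) set" where
  "bidual sY = dual fscale (ydual sY) (dual_norm UNIV norm)"

definition bidual_norm ::
  "('k::real_normed_field \<Rightarrow> 'y::real_normed_vector \<Rightarrow> 'y) \<Rightarrow> (('y \<Rightarrow> 'k) \<Rightarrow> 'k) \<Rightarrow> real" where
  "bidual_norm sY = dual_norm (ydual sY) (dual_norm UNIV norm)"

definition canonical_embedding ::
  "('k::real_normed_field \<Rightarrow> 'y::real_normed_vector \<Rightarrow> 'y) \<Rightarrow> 'y \<Rightarrow> ('y \<Rightarrow> 'k) \<Rightarrow> 'k" where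
  "canonical_embedding sY y = (\<lambda>\<phi>. if \<phi> \<in> ydual sY then \<phi> y else 0)"

text \<open>There is a bounded linear projection of the bidual onto \<open>Y\<close>, where \<open>Y\<close> is regarded as a
  subspace of its bidual by means of the canonical embedding.\<close>

definition complemented_in_bidual ::
  "('k::real_normed_field \<Rightarrow> 'y::real_normed_vector \<Rightarrow> 'y) \<Rightarrow> bool" where
  "complemented_in_bidual sY \<longleftrightarrow>
     (\<exists>P. linear_on fscale (bidual sY) sY P \<and>
          (\<exists>B. \<forall>\<Psi>\<in>bidual sY. norm (P \<Psi>) \<le> B * bidual_norm sY \<Psi>) \<and>
          (\<forall>y. P (canonical_embedding sY y) = y))"


section \<open>Koethe function spaces\<close>

definition quasi_norm_on ::
  "'a measure \<Rightarrow> ('a \<Rightarrow> 'k::real_normed_field) set \<Rightarrow> (('a \<Rightarrow> 'k) \<Rightarrow> real) \<Rightarrow> bool" where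
  "quasi_norm_on M K N \<longleftrightarrow>
     (\<forall>f\<in>K. 0 \<le> N f) \<and>
     (\<forall>f\<in>K. N f = 0 \<longleftrightarrow> (AE x in M. f x = 0)) \<and>
     (\<forall>c. \<forall>f\<in>K. N (fscale c f) = norm c * N f) \<and>
     (\<exists>Q. \<forall>f\<in>K. \<forall>g\<in>K. N (f + g) \<le> Q * (N f + N g))"

text \<open>The lattice condition is the usual one, with \<open>\<bar>f\<bar> \<le> \<bar>g\<bar>\<close> for arbitrary \<open>g\<close> in \<open>K\<close>.  (A
  condition on nonnegative \<open>g\<close> only would not make \<open>K\<close> closed under absolute values.)  It
  also makes \<open>K\<close> and \<open>N\<close> compatible with equality almost everywhere.\<close>

definition koethe_space ::
  "'a measure \<Rightarrow> ('a \<Rightarrow> 'k::{real_normed_field, euclidean_space}) set \<Rightarrow>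
     (('a \<Rightarrow> 'k) \<Rightarrow> real) \<Rightarrow> bool" where
  "koethe_space M K N \<longleftrightarrow>
     K \<subseteq> borel_measurable M \<and> fvec.subspace K \<and> quasi_norm_on M K N \<and>
     (\<forall>f\<in>borel_measurable M. \<forall>g\<in>K.
        (AE x in M. norm (f x) \<le> norm (g x)) \<longrightarrow> f \<in> K \<and> N f \<le> N g) \<and>
     (\<forall>A\<in>sets M. emeasure M A < \<infinity> \<longrightarrow> indicator A \<in> K)"

definition disjoint_supports ::
  "'a measure \<Rightarrow> ('a \<Rightarrow> 'k::zero) \<Rightarrow> ('a \<Rightarrow> 'k) \<Rightarrow> bool" where
  "disjoint_supports M f g \<longleftrightarrow> (AE x in M. f x = 0 \<or> g x = 0)"

definition closed_span ::
  "('a \<Rightarrow> 'k::field) set \<Rightarrow> (('a \<Rightarrow> 'k) \<Rightarrow> real) \<Rightarrow> ('a \<Rightarrow> 'k) set \<Rightarrow> ('a \<Rightarrow> 'k) set" where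
  "closed_span K N U = {f\<in>K. \<forall>\<epsilon>>0. \<exists>g\<in>fvec.span U. N (f - g) < \<epsilon>}"


section \<open>Quasi-linear maps and triviality\<close>

definition quasi_linear ::
  "'a measure \<Rightarrow> ('a \<Rightarrow> 'k::real_normed_field) set \<Rightarrow> (('a \<Rightarrow> 'k) \<Rightarrow> real) \<Rightarrow>
     ('k \<Rightarrow> 'y::real_normed_vector \<Rightarrow> 'y) \<Rightarrow> (('a \<Rightarrow> 'k) \<Rightarrow> 'y) \<Rightarrow> bool" where
  "quasi_linear M K N sY \<Omega> \<longleftrightarrow>
     (\<forall>f\<in>K. \<forall>g\<in>K. (AE x in M. f x = g x) \<longrightarrow> \<Omega> f = \<Omega> g) \<and>
     (\<forall>c. \<forall>f\<in>K. \<Omega> (fscale c f) = sY c (\<Omega> f)) \<and>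
     (\<exists>C. \<forall>f\<in>K. \<forall>g\<in>K. norm (\<Omega> (f + g) - \<Omega> f - \<Omega> g) \<le> C * (N f + N g))"

text \<open>The distance \<open>\<parallel>S - T\<parallel>\<close> of two homogeneous maps on a subspace \<open>F\<close>.  If \<open>S\<close> is well defined
  on classes of functions and the distance is finite, then \<open>T\<close> is well defined on classes as
  well; this is why it is not required of the linear maps below.\<close>

definition hom_dist ::
  "('a \<Rightarrow> 'k) set \<Rightarrow> (('a \<Rightarrow> 'k) \<Rightarrow> real) \<Rightarrow> (('a \<Rightarrow> 'k) \<Rightarrow> 'y::real_normed_vector) \<Rightarrow>
     (('a \<Rightarrow> 'k) \<Rightarrow> 'y) \<Rightarrow> ereal" where
  "hom_dist F N S T = (SUP f\<in>{f\<in>F. N f \<le> 1}. ereal (norm (S f - T f)))"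

definition trivial_on ::
  "('a \<Rightarrow> 'k::field) set \<Rightarrow> (('a \<Rightarrow> 'k) \<Rightarrow> real) \<Rightarrow> ('k \<Rightarrow> 'y::real_normed_vector \<Rightarrow> 'y) \<Rightarrow>
     (('a \<Rightarrow> 'k) \<Rightarrow> 'y) \<Rightarrow> bool" where
  "trivial_on X N sY \<Omega> \<longleftrightarrow> (\<exists>L. linear_on fscale X sY L \<and> hom_dist X N \<Omega> L < \<infinity>)"

text \<open>Finite-dimensional subspaces are the spans of finite sets.\<close>

definition locally_trivial ::
  "('a \<Rightarrow> 'k::field) set \<Rightarrow> (('a \<Rightarrow> 'k) \<Rightarrow> real) \<Rightarrow> ('k \<Rightarrow> 'y::real_normed_vector \<Rightarrow> 'y) \<Rightarrow>
     (('a \<Rightarrow> 'k) \<Rightarrow> 'y) \<Rightarrow> bool" where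
  "locally_trivial X N sY \<Omega> \<longleftrightarrow>
     (\<exists>C>0. \<forall>B. finite B \<and> B \<subseteq> X \<longrightarrow>
        (\<exists>L. linear_on fscale (fvec.span B) sY L \<and> hom_dist (fvec.span B) N \<Omega> L \<le> ereal C))"

definition disjointly_trivial ::
  "'a measure \<Rightarrow> ('a \<Rightarrow> 'k::field) set \<Rightarrow> (('a \<Rightarrow> 'k) \<Rightarrow> real) \<Rightarrow>
     ('k \<Rightarrow> 'y::real_normed_vector \<Rightarrow> 'y) \<Rightarrow> (('a \<Rightarrow> 'k) \<Rightarrow> 'y) \<Rightarrow> bool" where
  "disjointly_trivial M K N sY \<Omega> \<longleftrightarrow>
     (\<forall>u :: nat \<Rightarrow> 'a \<Rightarrow> 'k.
        (\<forall>n. u n \<in> K) \<and> (\<forall>m n. m \<noteq> n \<longrightarrow> disjoint_supports M (u m) (u n)) \<longrightarrow>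
        trivial_on (closed_span K N (range u)) N sY \<Omega>)"

definition locally_disjointly_trivial ::
  "'a measure \<Rightarrow> ('a \<Rightarrow> 'k::field) set \<Rightarrow> (('a \<Rightarrow> 'k) \<Rightarrow> real) \<Rightarrow>
     ('k \<Rightarrow> 'y::real_normed_vector \<Rightarrow> 'y) \<Rightarrow> (('a \<Rightarrow> 'k) \<Rightarrow> 'y) \<Rightarrow> bool" where
  "locally_disjointly_trivial M K N sY \<Omega> \<longleftrightarrow>
     (\<exists>C>0. \<forall>B. finite B \<and> B \<subseteq> K \<and> pairwise (disjoint_supports M) B \<longrightarrow>
        (\<exists>L. linear_on fscale (fvec.span B) sY L \<and> hom_dist (fvec.span B) N \<Omega> L \<le> ereal C))"

end

theory Submission
  imports Defs
begin

text \<open>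
  That local triviality implies triviality if \<open>Y\<close> is complemented in its bidual is a compactness
  argument: the linear maps on the finite-dimensional subspaces, regarded as maps into the bidual, are
  pointwise bounded and hence have a weak-\<open>*\<close> cluster point, which is linear and close to \<open>\<Omega>\<close>
  (\<open>linear_map_into_bidual\<close>). The projection of the bidual onto \<open>Y\<close> turns it into a linear map
  with values in \<open>Y\<close>.

  Disjoint triviality implies its local version by a gliding hump.  If there is no uniform constant for the
  finite disjoint families, then one finds such families, each worse than the preceding ones, whose
  supports are disjoint from each other. Their union is a disjoint sequence, and the restriction of
  \<open>\<Omega>\<close> to its closed span is not trivial.  To find them, note that if there is no uniform constant
  for the families supported in \<open>S \<union> T\<close>, then there is none for \<open>S\<close> or none for \<open>T\<close>, since
  functions can be cut into two pieces (\<open>uniformly_trivial_Un\<close>). Hence, after choosing one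
  badly behaved family, the badness persists off the supports of its members or on the support
  of one member, and in the second case this member can be removed from the family at bounded cost
  (\<open>hump_step\<close>).

  Local disjoint triviality implies local triviality because finitely many functions are small
  perturbations of combinations of disjointly supported ones (\<open>disjoint_approximation\<close>). A
  quasi-linear map need not be continuous, so the smallness of the perturbation does not
  help by itself; but on a space of fixed finite dimension, the map that is linear with the same values on
  a basis differs from \<open>\<Omega>\<close> by at most a multiple of the size of the basis vectors
  (\<open>finite_sum_bounds\<close>). The perturbation is chosen small relative to this multiple and to the
  constant by which the quasi-norm controls the coefficients (\<open>independent_coefficient_bound\<close>).
  The latter exists for functions that are linearly independent modulo null functions, and dependent
  ones can be dropped (\<open>trivial_family_dependent\<close>).
\<close>

section \<open>Combinations of functions and linear maps on spans\<close>

lemma fscale_apply: "fscale c f x = c * f x"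
  by (simp add: fscale_def)

abbreviation combination :: "'i set \<Rightarrow> ('i \<Rightarrow> 'k::field) \<Rightarrow> ('i \<Rightarrow> 'a \<Rightarrow> 'k) \<Rightarrow> 'a \<Rightarrow> 'k" where
  "combination I c u \<equiv> (\<Sum>i\<in>I. fscale (c i) (u i))"

lemma sum_fun_apply: "(\<Sum>i\<in>I. u i) x = (\<Sum>i\<in>I. u i x)"
  for u :: "'i \<Rightarrow> 'a \<Rightarrow> 'k::comm_monoid_add"
  by (induction I rule: infinite_finite_induct) auto

lemma combination_apply: "combination I c u x = (\<Sum>i\<in>I. c i * u i x)"
  by (simp add: sum_fun_apply fscale_apply)

lemma combination_add_family:
  "combination I c (\<lambda>i. u i + v i) = combination I c u + combination I c v"
  by (simp add: fvec.scale_right_distrib sum.distrib)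

lemma linear_on_zero:
  assumes "linear_on fscale X sY L" "vector_space sY" "fvec.subspace X"
  shows "L (0 :: 'a \<Rightarrow> 'k::field) = (0 :: 'y::ab_group_add)"
proof -
  interpret y: vector_space sY by fact
  have "L (fscale 0 0) = sY 0 (L 0)"
    using assms(1) fvec.subspace_0[OF assms(3)] unfolding linear_on_def by blast
  then show ?thesis by simp
qed

lemma linear_on_combination:
  assumes "linear_on fscale X sY L" "vector_space sY" "fvec.subspace X" "u ` I \<subseteq> X"
  shows "L (combination I c u) = (\<Sum>i\<in>I. sY (c i) (L (u i) :: 'y::ab_group_add))"
  using assms(4)
proof (induction I rule: infinite_finite_induct)
  case (insert i I)
  have "fscale (c i) (u i) \<in> X" "combination I c u \<in> X"
    using insert.prems by (auto intro!: fvec.subspace_scale fvec.subspace_sum assms(3))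
  then show ?case
    using insert assms(1) unfolding linear_on_def by (simp del: plus_fun_apply)
qed (simp_all add: linear_on_zero[OF assms(1-3)])

lemma trivial_on_subset:
  assumes "trivial_on Y N sY \<Omega>" "X \<subseteq> Y"
  shows "trivial_on X N sY \<Omega>"
proof -
  obtain L where L: "linear_on fscale Y sY L" "hom_dist Y N \<Omega> L < \<infinity>"
    using assms(1) by (auto simp: trivial_on_def)
  have "hom_dist X N \<Omega> L \<le> hom_dist Y N \<Omega> L"
    unfolding hom_dist_def using assms(2) by (intro SUP_subset_mono) auto
  moreover have "linear_on fscale X sY L"
    using L(1) assms(2) unfolding linear_on_def by blast
  ultimately show ?thesis
    using L(2) unfolding trivial_on_def by (intro exI[of _ L]) auto
qed

section \<open>The setting\<close>

text \<open>The constants of the quasi-norm and of the quasi-linear map are named, because the bounds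
  below have to be uniform over all finite families.\<close>

locale quasi_linear_map =
  fixes M :: "'a measure"
    and K :: "('a \<Rightarrow> 'k::{real_normed_field, euclidean_space}) set"
    and N :: "('a \<Rightarrow> 'k) \<Rightarrow> real"
    and sY :: "'k \<Rightarrow> 'y::banach \<Rightarrow> 'y"
    and \<Omega> :: "('a \<Rightarrow> 'k) \<Rightarrow> 'y"
    and Q Z :: real
  assumes koethe: "koethe_space M K N"
    and banach: "banach_over sY"
    and quasi_linear: "quasi_linear M K N sY \<Omega>"
    and Q_ge_1: "1 \<le> Q"
    and N_add: "\<And>f g. f \<in> K \<Longrightarrow> g \<in> K \<Longrightarrow> N (f + g) \<le> Q * (N f + N g)"
    and Z_nonneg: "0 \<le> Z"
    and \<Omega>_add: "\<And>f g. f \<in> K \<Longrightarrow> g \<in> K \<Longrightarrow> norm (\<Omega> (f + g) - \<Omega> f - \<Omega> g) \<le> Z * (N f + N g)"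
begin

lemma K_subspace: "fvec.subspace K"
  using koethe by (simp add: koethe_space_def)

lemmas K_zero = fvec.subspace_0[OF K_subspace]
lemmas K_diff = fvec.subspace_diff[OF K_subspace]
lemmas K_scale = fvec.subspace_scale[OF K_subspace]

lemma K_combination: "(\<And>i. i \<in> I \<Longrightarrow> u i \<in> K) \<Longrightarrow> combination I c u \<in> K"
  by (intro fvec.subspace_sum[OF K_subspace] K_scale)

lemma K_measurable: "f \<in> K \<Longrightarrow> f \<in> borel_measurable M"
  using koethe by (auto simp: koethe_space_def)

lemma K_dominated:
  assumes "f \<in> borel_measurable M" "g \<in> K" "AE x in M. norm (f x) \<le> norm (g x)"
  shows "f \<in> K" and "N f \<le> N g"
  using koethe assms unfolding koethe_space_def by blast+

lemma N_nonneg: "f \<in> K \<Longrightarrow> 0 \<le> N f"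
  using koethe by (simp add: koethe_space_def quasi_norm_on_def)

lemma N_null: "f \<in> K \<Longrightarrow> N f = 0 \<longleftrightarrow> (AE x in M. f x = 0)"
  using koethe by (simp add: koethe_space_def quasi_norm_on_def)

lemma N_scale: "f \<in> K \<Longrightarrow> N (fscale c f) = norm c * N f"
  using koethe by (simp add: koethe_space_def quasi_norm_on_def)

lemma N_zero: "N 0 = 0"
  using N_null[OF K_zero] by simp

lemma N_AE_cong: "f \<in> K \<Longrightarrow> g \<in> K \<Longrightarrow> AE x in M. f x = g x \<Longrightarrow> N f = N g"
  by (intro order_antisym K_dominated(2) K_measurable) auto

sublocale y: vector_space sY
  using banach by (simp add: banach_over_def)

lemma norm_sY: "norm (sY c v) = norm c * norm v"
  using banach by (simp add: banach_over_def)

lemma sY_of_real: "sY (of_real r) v = r *\<^sub>R v"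
  using banach by (simp add: banach_over_def)

lemma \<Omega>_AE_cong: "f \<in> K \<Longrightarrow> g \<in> K \<Longrightarrow> AE x in M. f x = g x \<Longrightarrow> \<Omega> f = \<Omega> g"
  using quasi_linear unfolding quasi_linear_def by blast

lemma \<Omega>_scale: "f \<in> K \<Longrightarrow> \<Omega> (fscale c f) = sY c (\<Omega> f)"
  using quasi_linear unfolding quasi_linear_def by blast

lemma \<Omega>_zero: "\<Omega> 0 = 0"
  using \<Omega>_scale[OF K_zero, of 0] by simp

text \<open>Homogeneity turns the bound on the unit ball into a bound by a multiple of the quasi-norm.
  On the null functions it forces equality, since they stay in the unit ball under scaling.\<close>

lemma hom_dist_le_iff:
  assumes X: "fvec.subspace X" "X \<subseteq> K" and L: "linear_on fscale X sY L" and C: "0 \<le> C"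
  shows "hom_dist X N \<Omega> L \<le> ereal C \<longleftrightarrow> (\<forall>f\<in>X. norm (\<Omega> f - L f) \<le> C * N f)"
proof
  assume bound: "hom_dist X N \<Omega> L \<le> ereal C"
  have scaled: "r * norm (\<Omega> f - L f) \<le> C" if "f \<in> X" "0 \<le> r" "r * N f \<le> 1" for f r
  proof -
    let ?g = "fscale (of_real r :: 'k) f"
    have fK: "f \<in> K" using that X by blast
    have "?g \<in> X" using that X by (intro fvec.subspace_scale)
    moreover have "N ?g \<le> 1" using that by (simp add: N_scale[OF fK])
    ultimately have "ereal (norm (\<Omega> ?g - L ?g)) \<le> hom_dist X N \<Omega> L"
      unfolding hom_dist_def by (intro SUP_upper CollectI conjI)
    then have "norm (\<Omega> ?g - L ?g) \<le> C" using bound by (meson ereal_less_eq(3) order_trans)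
    moreover have "\<Omega> ?g - L ?g = r *\<^sub>R (\<Omega> f - L f)"
      using L that \<Omega>_scale[OF fK] by (simp add: linear_on_def sY_of_real scaleR_diff_right)
    ultimately show ?thesis using that by simp
  qed
  show "\<forall>f\<in>X. norm (\<Omega> f - L f) \<le> C * N f"
  proof
    fix f assume f: "f \<in> X"
    then have "0 \<le> N f" using X N_nonneg by blast
    show "norm (\<Omega> f - L f) \<le> C * N f"
    proof (cases "N f = 0")
      case True
      have "norm (\<Omega> f - L f) \<le> 0"
      proof (rule ccontr)
        assume "\<not> ?thesis"
        then obtain n :: nat where "C < real n * norm (\<Omega> f - L f)"
          using reals_Archimedean3[of "norm (\<Omega> f - L f)"] by auto
        then show False using scaled[OF f, of "real n"] True by simp
      qed
      then show ?thesis using True by simp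
    next
      case False
      then show ?thesis
        using scaled[OF f, of "1 / N f"] \<open>0 \<le> N f\<close> by (simp add: field_simps)
    qed
  qed
next
  assume "\<forall>f\<in>X. norm (\<Omega> f - L f) \<le> C * N f"
  then have "norm (\<Omega> f - L f) \<le> C" if "f \<in> X" "N f \<le> 1" for f
    using that C mult_left_mono[of "N f" 1 C] by fastforce
  then show "hom_dist X N \<Omega> L \<le> ereal C"
    unfolding hom_dist_def by (intro SUP_least) auto
qed

lemma trivial_on_iff:
  assumes X: "fvec.subspace X" "X \<subseteq> K"
  shows "trivial_on X N sY \<Omega> \<longleftrightarrow>
    (\<exists>L C. linear_on fscale X sY L \<and> 0 \<le> C \<and> (\<forall>f\<in>X. norm (\<Omega> f - L f) \<le> C * N f))"
proof
  assume "trivial_on X N sY \<Omega>"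
  then obtain L where L: "linear_on fscale X sY L" "hom_dist X N \<Omega> L < \<infinity>"
    by (auto simp: trivial_on_def)
  have "ereal (norm (\<Omega> 0 - L 0)) \<le> hom_dist X N \<Omega> L"
    unfolding hom_dist_def using fvec.subspace_0[OF X(1)] N_zero by (intro SUP_upper CollectI conjI) (simp_all del: zero_fun_apply)
  then have "0 \<le> hom_dist X N \<Omega> L"
    using norm_ge_zero order_trans zero_ereal_def ereal_less_eq(3) by metis
  then obtain C where "hom_dist X N \<Omega> L = ereal C" "0 \<le> C"
    using L(2) by (cases "hom_dist X N \<Omega> L") auto
  then show "\<exists>L C. linear_on fscale X sY L \<and> 0 \<le> C \<and> (\<forall>f\<in>X. norm (\<Omega> f - L f) \<le> C * N f)"
    using hom_dist_le_iff[OF X L(1)] L(1) by (metis order_refl)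
next
  assume "\<exists>L C. linear_on fscale X sY L \<and> 0 \<le> C \<and> (\<forall>f\<in>X. norm (\<Omega> f - L f) \<le> C * N f)"
  then obtain L C where "linear_on fscale X sY L" "hom_dist X N \<Omega> L \<le> ereal C"
    using hom_dist_le_iff[OF X] by blast
  then show "trivial_on X N sY \<Omega>"
    unfolding trivial_on_def by (intro exI[of _ L] conjI) (auto intro: le_less_trans)
qed

lemma span_subset_K: "B \<subseteq> K \<Longrightarrow> fvec.span B \<subseteq> K"
  by (intro fvec.span_minimal K_subspace)


section \<open>Finite families on which the map is nearly linear\<close>

text \<open>Linear maps on the span of a finite family are replaced by the images \<open>y\<close> of its members.
  Then the members of the family can be split, cut or changed on null sets without any regard to
  linear relations among the resulting functions.
  The bound \<open>p\<close> is an arbitrary function of the coefficients, because a family is treated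
  by decomposing its members into two parts, and the parts have to be bounded in terms
  of the combination of the original family.\<close>

definition nearly_linear :: "'i set \<Rightarrow> ('i \<Rightarrow> 'a \<Rightarrow> 'k) \<Rightarrow> (('i \<Rightarrow> 'k) \<Rightarrow> real) \<Rightarrow> bool" where
  "nearly_linear I u p \<longleftrightarrow>
     (\<exists>y. \<forall>c. norm (\<Omega> (combination I c u) - (\<Sum>i\<in>I. sY (c i) (y i))) \<le> p c)"

definition trivial_family :: "real \<Rightarrow> 'i set \<Rightarrow> ('i \<Rightarrow> 'a \<Rightarrow> 'k) \<Rightarrow> bool" where
  "trivial_family C I u \<longleftrightarrow> nearly_linear I u (\<lambda>c. C * N (combination I c u))"

lemma nearly_linear_mono:
  "nearly_linear I u p \<Longrightarrow> (\<And>c. p c \<le> q c) \<Longrightarrow> nearly_linear I u q"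
  unfolding nearly_linear_def by (meson order_trans)

lemma trivial_family_mono:
  assumes "trivial_family C I u" "C \<le> C'" "u ` I \<subseteq> K"
  shows "trivial_family C' I u"
  using assms(1) unfolding trivial_family_def
  by (rule nearly_linear_mono) (use assms in \<open>auto intro!: mult_right_mono N_nonneg K_combination\<close>)

text \<open>The last summand of the bound is the error of \<open>\<Omega>\<close> on the sum of the two combinations.\<close>

lemma nearly_linear_add:
  assumes u: "nearly_linear I u p" "\<And>i. i \<in> I \<Longrightarrow> u i \<in> K"
    and v: "nearly_linear I v q" "\<And>i. i \<in> I \<Longrightarrow> v i \<in> K"
  shows "nearly_linear I (\<lambda>i. u i + v i)
    (\<lambda>c. p c + q c + Z * (N (combination I c u) + N (combination I c v)))"
proof -
  obtain y where y: "\<And>c. norm (\<Omega> (combination I c u) - (\<Sum>i\<in>I. sY (c i) (y i))) \<le> p c"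
    using u by (auto simp: nearly_linear_def)
  obtain z where z: "\<And>c. norm (\<Omega> (combination I c v) - (\<Sum>i\<in>I. sY (c i) (z i))) \<le> q c"
    using v by (auto simp: nearly_linear_def)
  have "norm (\<Omega> (combination I c (\<lambda>i. u i + v i)) - (\<Sum>i\<in>I. sY (c i) (y i + z i)))
        \<le> p c + q c + Z * (N (combination I c u) + N (combination I c v))" for c
  proof -
    let ?f = "combination I c u" and ?g = "combination I c v"
    let ?s = "\<Sum>i\<in>I. sY (c i) (y i)" and ?t = "\<Sum>i\<in>I. sY (c i) (z i)"
    have "norm (\<Omega> (combination I c (\<lambda>i. u i + v i)) - (\<Sum>i\<in>I. sY (c i) (y i + z i))) =
      norm ((\<Omega> ?f - ?s) + (\<Omega> ?g - ?t) + (\<Omega> (?f + ?g) - \<Omega> ?f - \<Omega> ?g))"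
      by (simp add: combination_add_family y.scale_right_distrib sum.distrib algebra_simps)
    also have "\<dots> \<le> norm (\<Omega> ?f - ?s) + norm (\<Omega> ?g - ?t) + norm (\<Omega> (?f + ?g) - \<Omega> ?f - \<Omega> ?g)"
      by (intro order_trans[OF norm_triangle_ineq] add_mono norm_triangle_ineq order_refl)
    also have "\<dots> \<le> p c + q c + Z * (N ?f + N ?g)"
      using y[of c] z[of c] \<Omega>_add[of ?f ?g] u(2) v(2) by (fastforce intro!: add_mono K_combination)
    finally show ?thesis .
  qed
  then show ?thesis
    unfolding nearly_linear_def by (intro exI[of _ "\<lambda>i. y i + z i"] allI)
qed

text \<open>On a line the map is already linear, by homogeneity.\<close>

lemma nearly_linear_single:
  assumes "finite I" "b \<in> I" "u b \<in> K"
  shows "nearly_linear I (\<lambda>i. if i = b then u i else 0) (\<lambda>c. 0)"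
proof -
  have "combination I c (\<lambda>i. if i = b then u i else 0) = fscale (c b) (u b)" for c
    using assms by (simp add: if_distrib[of "fscale _"] sum.delta cong: if_cong)
  moreover have "(\<Sum>i\<in>I. sY (c i) (if i = b then \<Omega> (u b) else 0)) = sY (c b) (\<Omega> (u b))" for c
    using assms by (simp add: if_distrib[of "sY _"] sum.delta cong: if_cong)
  ultimately show ?thesis
    unfolding nearly_linear_def using \<Omega>_scale[OF assms(3)]
    by (intro exI[of _ "\<lambda>i. if i = b then \<Omega> (u b) else 0"]) simp
qed

lemma trivial_family_of_linear:
  assumes X: "fvec.subspace X" and L: "linear_on fscale X sY L"
    and bound: "\<And>f. f \<in> X \<Longrightarrow> norm (\<Omega> f - L f) \<le> C * N f" and u: "u ` I \<subseteq> X"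
  shows "trivial_family C I u"
  unfolding trivial_family_def nearly_linear_def
proof (intro exI[of _ "\<lambda>i. L (u i)"] allI)
  fix c
  have "combination I c u \<in> X"
    using u by (intro fvec.subspace_sum[OF X] fvec.subspace_scale[OF X]) auto
  from bound[OF this]
  show "norm (\<Omega> (combination I c u) - (\<Sum>i\<in>I. sY (c i) (L (u i)))) \<le> C * N (combination I c u)"
    using linear_on_combination[OF L y.vector_space_axioms X u] by simp
qed

text \<open>Conversely, the images of the members extend to a linear map on the span: if a combination
  vanishes, then the bound shows that the corresponding combination of the images vanishes, too.\<close>

lemma linear_of_trivial_family:
  assumes B: "finite B" "B \<subseteq> K" and C: "trivial_family C B (\<lambda>b. b)"
  obtains L where "linear_on fscale (fvec.span B) sY L"
    and "\<And>f. f \<in> fvec.span B \<Longrightarrow> norm (\<Omega> f - L f) \<le> C * N f"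
proof -
  let ?\<sigma> = "\<lambda>c. combination B c (\<lambda>b. b)"
  obtain y where y: "\<And>c. norm (\<Omega> (?\<sigma> c) - (\<Sum>b\<in>B. sY (c b) (y b))) \<le> C * N (?\<sigma> c)"
    using C by (auto simp: trivial_family_def nearly_linear_def)
  let ?\<tau> = "\<lambda>c. \<Sum>b\<in>B. sY (c b) (y b)"
  have span: "fvec.span B = range ?\<sigma>"
    using fvec.span_finite[OF B(1)] by auto
  have \<sigma>_add: "?\<sigma> (\<lambda>b. c b + d b) = ?\<sigma> c + ?\<sigma> d" for c d
    by (simp add: fvec.scale_left_distrib sum.distrib)
  have \<sigma>_scale: "?\<sigma> (\<lambda>b. a * c b) = fscale a (?\<sigma> c)" for a c
    by (simp add: fvec.scale_sum_right)
  have \<tau>_add: "?\<tau> (\<lambda>b. c b + d b) = ?\<tau> c + ?\<tau> d" for c d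
    by (simp add: y.scale_left_distrib sum.distrib)
  have \<tau>_scale: "?\<tau> (\<lambda>b. a * c b) = sY a (?\<tau> c)" for a c
    by (simp add: y.scale_sum_right)
  have eq: "?\<tau> c = ?\<tau> d" if "?\<sigma> c = ?\<sigma> d" for c d
  proof -
    have "?\<sigma> (\<lambda>b. c b + (-1) * d b) = 0"
      using that by (simp only: \<sigma>_add \<sigma>_scale) (simp add: fvec.scale_minus_left)
    then have "norm (?\<tau> (\<lambda>b. c b + (-1) * d b)) \<le> 0"
      using y[of "\<lambda>b. c b + (-1) * d b"] by (simp only: \<Omega>_zero N_zero) simp
    then show ?thesis by (simp only: \<tau>_add \<tau>_scale) (simp add: y.scale_minus_left)
  qed
  define L where "L f = ?\<tau> (SOME c. ?\<sigma> c = f)" for f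
  have L: "L (?\<sigma> c) = ?\<tau> c" for c
    unfolding L_def by (intro eq) (rule someI[of "\<lambda>d. ?\<sigma> d = ?\<sigma> c" c], simp)
  show thesis
  proof (rule that)
    show "linear_on fscale (fvec.span B) sY L"
      unfolding linear_on_def span
    proof (intro conjI ballI allI)
      fix f g assume "f \<in> range ?\<sigma>" "g \<in> range ?\<sigma>"
      then obtain c d where "f = ?\<sigma> c" "g = ?\<sigma> d" by blast
      then show "L (f + g) = L f + L g"
        using L[of c] L[of d] L[of "\<lambda>b. c b + d b"] by (simp only: \<sigma>_add \<tau>_add)
    next
      fix a f assume "f \<in> range ?\<sigma>"
      then obtain c where "f = ?\<sigma> c" by blast
      then show "L (fscale a f) = sY a (L f)"
        using L[of c] L[of "\<lambda>b. a * c b"] by (simp only: \<sigma>_scale \<tau>_scale)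
    qed
    show "norm (\<Omega> f - L f) \<le> C * N f" if "f \<in> fvec.span B" for f
      using that y L unfolding span by auto
  qed
qed

lemma linear_on_span_iff_trivial_family:
  assumes "finite B" "B \<subseteq> K" "0 \<le> C"
  shows "(\<exists>L. linear_on fscale (fvec.span B) sY L \<and> hom_dist (fvec.span B) N \<Omega> L \<le> ereal C) \<longleftrightarrow>
    trivial_family C B (\<lambda>b. b)"
proof -
  have bound: "hom_dist (fvec.span B) N \<Omega> L \<le> ereal C \<longleftrightarrow>
      (\<forall>f\<in>fvec.span B. norm (\<Omega> f - L f) \<le> C * N f)"
    if "linear_on fscale (fvec.span B) sY L" for L
    using hom_dist_le_iff[OF fvec.subspace_span span_subset_K that] assms by simp
  show ?thesis
  proof
    assume "\<exists>L. linear_on fscale (fvec.span B) sY L \<and> hom_dist (fvec.span B) N \<Omega> L \<le> ereal C"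
    then obtain L where "linear_on fscale (fvec.span B) sY L"
      and "\<And>f. f \<in> fvec.span B \<Longrightarrow> norm (\<Omega> f - L f) \<le> C * N f"
      using bound by blast
    then show "trivial_family C B (\<lambda>b. b)"
      by (rule trivial_family_of_linear[OF fvec.subspace_span]) (auto intro: fvec.span_base)
  next
    assume "trivial_family C B (\<lambda>b. b)"
    then obtain L where "linear_on fscale (fvec.span B) sY L"
      and "\<And>f. f \<in> fvec.span B \<Longrightarrow> norm (\<Omega> f - L f) \<le> C * N f"
      using linear_of_trivial_family[OF assms(1,2)] by metis
    then show "\<exists>L. linear_on fscale (fvec.span B) sY L \<and> hom_dist (fvec.span B) N \<Omega> L \<le> ereal C"
      using bound by blast
  qed
qed

text \<open>Different members of a family may be cut down to the same function.  This lemma makes bounds for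
  sets of functions applicable to such families.\<close>

lemma trivial_family_image:
  assumes "finite I" "u ` I \<subseteq> K" "trivial_family C (u ` I) (\<lambda>b. b)"
  shows "trivial_family C I u"
proof -
  obtain L where "linear_on fscale (fvec.span (u ` I)) sY L"
    "\<And>f. f \<in> fvec.span (u ` I) \<Longrightarrow> norm (\<Omega> f - L f) \<le> C * N f"
    using linear_of_trivial_family[OF _ assms(2,3)] assms(1) by blast
  then show ?thesis
    by (rule trivial_family_of_linear[OF fvec.subspace_span]) (auto intro: fvec.span_base)
qed

lemma locally_trivial_iff:
  "locally_trivial K N sY \<Omega> \<longleftrightarrow>
     (\<exists>C>0. \<forall>B. finite B \<and> B \<subseteq> K \<longrightarrow> trivial_family C B (\<lambda>b. b))"
  unfolding locally_trivial_def
  by (intro ex_cong1 conj_cong refl all_cong1 imp_cong linear_on_span_iff_trivial_family) auto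

lemma locally_disjointly_trivial_iff:
  "locally_disjointly_trivial M K N sY \<Omega> \<longleftrightarrow>
     (\<exists>C>0. \<forall>B. finite B \<and> B \<subseteq> K \<and> pairwise (disjoint_supports M) B \<longrightarrow>
        trivial_family C B (\<lambda>b. b))"
  unfolding locally_disjointly_trivial_def
  by (intro ex_cong1 conj_cong refl all_cong1 imp_cong linear_on_span_iff_trivial_family) auto

end

section \<open>Cutting functions by measurable sets\<close>

definition cutoff :: "'a set \<Rightarrow> ('a \<Rightarrow> 'k::zero) \<Rightarrow> 'a \<Rightarrow> 'k" where
  "cutoff S f = (\<lambda>x. if x \<in> S then f x else 0)"

lemma cutoff_combination: "cutoff S (combination I c u) = combination I c (\<lambda>i. cutoff S (u i))"
  by (rule ext) (simp add: cutoff_def combination_apply)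

lemma cutoff_add_Compl: "cutoff S f + cutoff (- S) f = f" for f :: "'a \<Rightarrow> 'k::monoid_add"
  by (rule ext) (simp add: cutoff_def)

lemma disjoint_supports_cutoff:
  "disjoint_supports M f g \<Longrightarrow> disjoint_supports M (cutoff S f) (cutoff S g)"
  unfolding disjoint_supports_def cutoff_def by (auto elim: eventually_mono)

lemma disjoint_supports_sym: "disjoint_supports M f g \<Longrightarrow> disjoint_supports M g f"
  unfolding disjoint_supports_def by (auto elim: eventually_mono)

context quasi_linear_map
begin

lemma cutoff_K:
  assumes "f \<in> K" "S \<inter> space M \<in> sets M"
  shows "cutoff S f \<in> K" and "N (cutoff S f) \<le> N f"
proof -
  have "cutoff S f \<in> borel_measurable M"
    unfolding cutoff_def using K_measurable[OF assms(1)] assms(2)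
    by (intro measurable_If_set) auto
  moreover have "AE x in M. norm (cutoff S f x) \<le> norm (f x)"
    by (simp add: cutoff_def)
  ultimately show "cutoff S f \<in> K" "N (cutoff S f) \<le> N f"
    using K_dominated assms(1) by blast+
qed

section \<open>Gliding hump: disjointly trivial implies locally disjointly trivial\<close>

definition disjoint_set :: "'a set \<Rightarrow> ('a \<Rightarrow> 'k) set \<Rightarrow> bool" where
  "disjoint_set S B \<longleftrightarrow> finite B \<and> B \<subseteq> K \<and> pairwise (disjoint_supports M) B \<and>
     (\<forall>b\<in>B. AE x in M. x \<notin> S \<longrightarrow> b x = 0)"

definition uniformly_trivial :: "'a set \<Rightarrow> bool" where
  "uniformly_trivial S \<longleftrightarrow> (\<exists>C. \<forall>B. disjoint_set S B \<longrightarrow> trivial_family C B (\<lambda>b. b))"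

lemma disjoint_set_mono: "disjoint_set S B \<Longrightarrow> S \<subseteq> T \<Longrightarrow> disjoint_set T B"
  unfolding disjoint_set_def by (auto elim!: eventually_mono dest!: bspec)

lemma uniformly_trivial_mono: "uniformly_trivial T \<Longrightarrow> S \<subseteq> T \<Longrightarrow> uniformly_trivial S"
  unfolding uniformly_trivial_def using disjoint_set_mono by blast

lemma uniformly_trivialE:
  assumes "uniformly_trivial S"
  obtains C where "0 \<le> C" "\<And>B. disjoint_set S B \<Longrightarrow> trivial_family C B (\<lambda>b. b)"
proof -
  obtain C where C: "\<And>B. disjoint_set S B \<Longrightarrow> trivial_family C B (\<lambda>b. b)"
    using assms by (auto simp: uniformly_trivial_def)
  show thesis
    by (rule that[of "max C 0"]) (auto intro!: trivial_family_mono[OF C] simp: disjoint_set_def)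
qed

text \<open>Cutting the members of a disjoint family by \<open>S\<close> and by its complement does not increase the
  quasi-norm of any combination, so that bounds on both parts add up.\<close>

lemma uniformly_trivial_Un:
  assumes S: "S \<in> sets M" and "uniformly_trivial S" "uniformly_trivial T"
  shows "uniformly_trivial (S \<union> T)"
proof -
  obtain C where C: "0 \<le> C" "\<And>B. disjoint_set S B \<Longrightarrow> trivial_family C B (\<lambda>b. b)"
    using uniformly_trivialE[OF \<open>uniformly_trivial S\<close>] by blast
  obtain D where D: "0 \<le> D" "\<And>B. disjoint_set T B \<Longrightarrow> trivial_family D B (\<lambda>b. b)"
    using uniformly_trivialE[OF \<open>uniformly_trivial T\<close>] by blast
  have "trivial_family (C + D + 2 * Z) B (\<lambda>b. b)" if B: "disjoint_set (S \<union> T) B" for B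
  proof -
    have meas: "S \<inter> space M \<in> sets M" "- S \<inter> space M \<in> sets M"
      using S by (auto simp: Int_commute Compl_eq_Diff_UNIV Int_Diff)
    have fin: "finite B" and BK: "b \<in> B \<Longrightarrow> b \<in> K" for b
      using B by (auto simp: disjoint_set_def)
    have pw: "pairwise (disjoint_supports M) (cutoff R ` B)" for R
      using B unfolding disjoint_set_def pairwise_image
      by (auto simp: pairwise_def intro!: disjoint_supports_cutoff)
    have "disjoint_set S (cutoff S ` B)"
      using fin pw BK cutoff_K(1)[OF _ meas(1)] by (auto simp: disjoint_set_def cutoff_def)
    then have u: "trivial_family C B (cutoff S)"
      using C(2) fin BK cutoff_K(1)[OF _ meas(1)] by (auto intro!: trivial_family_image[of B "cutoff S"])
    have "AE x in M. x \<notin> T \<longrightarrow> cutoff (- S) b x = 0" if "b \<in> B" for b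
      using B that unfolding disjoint_set_def cutoff_def by (auto elim!: eventually_mono dest!: bspec)
    then have "disjoint_set T (cutoff (- S) ` B)"
      using fin pw BK cutoff_K(1)[OF _ meas(2)] by (auto simp: disjoint_set_def)
    then have v: "trivial_family D B (cutoff (- S))"
      using D(2) fin BK cutoff_K(1)[OF _ meas(2)] by (auto intro!: trivial_family_image[of B "cutoff (- S)"])
    have "nearly_linear B (\<lambda>b. cutoff S b + cutoff (- S) b)
      (\<lambda>c. C * N (combination B c (cutoff S)) + D * N (combination B c (cutoff (- S)))
         + Z * (N (combination B c (cutoff S)) + N (combination B c (cutoff (- S)))))"
      using u v BK cutoff_K(1) meas unfolding trivial_family_def by (intro nearly_linear_add) auto
    then show ?thesis
      unfolding cutoff_add_Compl trivial_family_def
    proof (rule nearly_linear_mono)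
      fix c
      let ?f = "combination B c (\<lambda>b. b)"
      have "?f \<in> K" using BK by (rule K_combination)
      then have "N (combination B c (cutoff S)) \<le> N ?f" "N (combination B c (cutoff (- S))) \<le> N ?f"
        using cutoff_K(2) meas by (simp_all flip: cutoff_combination)
      then have "C * N (combination B c (cutoff S)) \<le> C * N ?f"
        "D * N (combination B c (cutoff (- S))) \<le> D * N ?f"
        "Z * (N (combination B c (cutoff S)) + N (combination B c (cutoff (- S)))) \<le> Z * (N ?f + N ?f)"
        using C(1) D(1) Z_nonneg by (auto intro!: mult_left_mono)
      then show "C * N (combination B c (cutoff S)) + D * N (combination B c (cutoff (- S)))
         + Z * (N (combination B c (cutoff S)) + N (combination B c (cutoff (- S))))
         \<le> (C + D + 2 * Z) * N ?f"
        by (simp add: algebra_simps)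
    qed
  qed
  then show ?thesis unfolding uniformly_trivial_def by blast
qed

text \<open>Adding one vector with disjoint support costs no more than the quasi-linear estimate for
  splitting it off, where both parts have at most the quasi-norm of the sum, because the map is homogeneous on the line that it spans.\<close>

lemma trivial_family_insert:
  assumes B: "disjoint_set S B" and b: "b \<in> B" and C: "0 \<le> C"
    and triv: "trivial_family C (B - {b}) (\<lambda>b. b)"
  shows "trivial_family (C + 2 * Z) B (\<lambda>b. b)"
proof -
  have fin: "finite B" and BK: "a \<in> B \<Longrightarrow> a \<in> K" for a
    using B by (auto simp: disjoint_set_def)
  let ?u = "\<lambda>a. if a = b then a else 0" and ?v = "\<lambda>a. if a = b then 0 else a"
  have sum_u: "combination B c ?u = fscale (c b) b" for c
    using fin b by (simp add: if_distrib[of "fscale _"] sum.delta cong: if_cong del: zero_fun_apply)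
  have sum_v: "(\<Sum>a\<in>B. if a = b then 0 else h a) = (\<Sum>a\<in>B - {b}. h a)"
    for h :: "('a \<Rightarrow> 'k) \<Rightarrow> 'z::comm_monoid_add"
    using fin b by (subst sum.remove[of B b]) (auto intro: sum.cong)
  have comb_v: "combination B c ?v = combination (B - {b}) c (\<lambda>a. a)" for c
    unfolding sum_v[symmetric] by (intro sum.cong) auto
  obtain y where y: "\<And>c. norm (\<Omega> (combination (B - {b}) c (\<lambda>a. a)) - (\<Sum>a\<in>B - {b}. sY (c a) (y a)))
      \<le> C * N (combination (B - {b}) c (\<lambda>a. a))"
    using triv by (auto simp: trivial_family_def nearly_linear_def)
  have v: "nearly_linear B ?v (\<lambda>c. C * N (combination (B - {b}) c (\<lambda>a. a)))"
    unfolding nearly_linear_def comb_v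
  proof (intro exI[of _ "\<lambda>a. if a = b then 0 else y a"] allI)
    fix c
    have "(\<Sum>a\<in>B. sY (c a) (if a = b then 0 else y a)) = (\<Sum>a\<in>B - {b}. sY (c a) (y a))"
      unfolding sum_v[symmetric] by (intro sum.cong) auto
    then show "norm (\<Omega> (combination (B - {b}) c (\<lambda>a. a)) -
        (\<Sum>a\<in>B. sY (c a) (if a = b then 0 else y a))) \<le> C * N (combination (B - {b}) c (\<lambda>a. a))"
      using y[of c] by simp
  qed
  have "nearly_linear B (\<lambda>a. ?u a + ?v a) (\<lambda>c. 0 + C * N (combination (B - {b}) c (\<lambda>a. a))
      + Z * (N (combination B c ?u) + N (combination B c ?v)))"
    using fin b BK K_zero by (intro nearly_linear_add nearly_linear_single v) auto
  moreover have "(\<lambda>a. ?u a + ?v a) = (\<lambda>a. a)"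
    by (auto simp del: plus_fun_apply zero_fun_apply)
  ultimately have "nearly_linear B (\<lambda>a. a) (\<lambda>c. 0 + C * N (combination (B - {b}) c (\<lambda>a. a))
      + Z * (N (fscale (c b) b) + N (combination (B - {b}) c (\<lambda>a. a))))"
    unfolding sum_u comb_v by simp
  then show ?thesis
    unfolding trivial_family_def
  proof (rule nearly_linear_mono)
    fix c
    let ?f = "combination B c (\<lambda>a. a)"
    have fK: "?f \<in> K" and gK: "fscale (c b) b \<in> K" "combination (B - {b}) c (\<lambda>a. a) \<in> K"
      using BK b by (auto intro!: K_combination K_scale)
    have f: "?f = fscale (c b) b + combination (B - {b}) c (\<lambda>a. a)"
      using fin b by (rule sum.remove)
    have "AE x in M. \<forall>a\<in>B - {b}. b x = 0 \<or> a x = 0"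
      using B b by (intro AE_finite_allI) (auto simp: disjoint_set_def pairwise_def disjoint_supports_def)
    then have *: "AE x in M. fscale (c b) b x = 0 \<or> combination (B - {b}) c (\<lambda>a. a) x = 0"
      by eventually_elim (auto simp: combination_apply fscale_apply intro!: sum.neutral)
    have "N (fscale (c b) b) \<le> N ?f"
      by (rule K_dominated(2)[OF K_measurable fK]) (use gK * in \<open>auto simp: f elim!: eventually_mono\<close>)
    moreover have "N (combination (B - {b}) c (\<lambda>a. a)) \<le> N ?f"
      by (rule K_dominated(2)[OF K_measurable fK]) (use gK * in \<open>auto simp: f elim!: eventually_mono\<close>)
    ultimately have "C * N (combination (B - {b}) c (\<lambda>a. a)) \<le> C * N ?f"
      "Z * (N (fscale (c b) b) + N (combination (B - {b}) c (\<lambda>a. a))) \<le> Z * (N ?f + N ?f)"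
      using C Z_nonneg by (auto intro!: mult_left_mono)
    then show "0 + C * N (combination (B - {b}) c (\<lambda>a. a))
      + Z * (N (fscale (c b) b) + N (combination (B - {b}) c (\<lambda>a. a))) \<le> (C + 2 * Z) * N ?f"
      by (simp add: algebra_simps)
  qed
qed

text \<open>Call a set bad if it is not uniformly trivial.  Take a disjoint family in \<open>S\<close> that violates the
  bound \<open>n\<close> with the margin \<open>2 * Z\<close>.  If the part of \<open>S\<close> off all supports is bad, it serves as
  \<open>S'\<close>.  Otherwise \<open>S\<close> intersected with the support of some member \<open>b\<close> is bad and serves as \<open>S'\<close>;
  then \<open>b\<close> has to be discarded, and the margin makes up for this.\<close>

lemma hump_step:
  assumes S: "S \<in> sets M" and bad: "\<not> uniformly_trivial S" and n: "0 \<le> n"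
  obtains B S' where "disjoint_set S B" "\<not> trivial_family n B (\<lambda>b. b)"
    and "S' \<in> sets M" "S' \<subseteq> S" "\<not> uniformly_trivial S'" "\<And>b. b \<in> B \<Longrightarrow> AE x in M. x \<in> S' \<longrightarrow> b x = 0"
proof -
  obtain B where B: "disjoint_set S B" and B_bad: "\<not> trivial_family (n + 2 * Z) B (\<lambda>b. b)"
    using bad unfolding uniformly_trivial_def by blast
  have fin: "finite B" and BK: "b \<in> B \<Longrightarrow> b \<in> K" for b
    using B by (auto simp: disjoint_set_def)
  define A where "A b = {x \<in> space M. b x \<noteq> 0}" for b :: "'a \<Rightarrow> 'k"
  have A: "A b \<in> sets M" if "b \<in> B" for b
    unfolding A_def using K_measurable[OF BK[OF that]] by measurable
  let ?R = "S - (\<Union>b\<in>B. A b)"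
  have R: "?R \<in> sets M"
    using S A fin by auto
  show thesis
  proof (cases "uniformly_trivial ?R")
    case False
    have "\<not> trivial_family n B (\<lambda>b. b)"
      using B_bad trivial_family_mono[of n B "\<lambda>b. b" "n + 2 * Z"] BK Z_nonneg by auto
    then show thesis
      by (rule that[OF B _ R _ False]) (auto simp: A_def intro!: AE_I2)
  next
    case True
    have "\<exists>b\<in>B. \<not> uniformly_trivial (S \<inter> A b)"
    proof (rule ccontr)
      assume "\<not> ?thesis"
      then have triv_A: "uniformly_trivial (S \<inter> A b)" if "b \<in> B" for b using that by blast
      have "uniformly_trivial (?R \<union> (\<Union>b\<in>B'. S \<inter> A b))" if "B' \<subseteq> B" for B'
        using finite_subset[OF that fin] that
      proof (induction B')
        case (insert b B')
        then have "uniformly_trivial ((S \<inter> A b) \<union> (?R \<union> (\<Union>b\<in>B'. S \<inter> A b)))"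
          using S A[of b] triv_A[of b] by (intro uniformly_trivial_Un[of "S \<inter> A b"]) auto
        then show ?case by (rule uniformly_trivial_mono) auto
      qed (use True in simp)
      from this[OF order_refl] have "uniformly_trivial S" by (rule uniformly_trivial_mono) auto
      then show False using bad by blast
    qed
    then obtain b where b: "b \<in> B" and b_bad: "\<not> uniformly_trivial (S \<inter> A b)" by blast
    show thesis
    proof (rule that[OF _ _ _ _ b_bad])
      show "disjoint_set S (B - {b})"
        using B unfolding disjoint_set_def by (auto intro: pairwise_subset)
      show "\<not> trivial_family n (B - {b}) (\<lambda>b. b)"
        using B_bad trivial_family_insert[OF B b n] by blast
      show "S \<inter> A b \<in> sets M" using S A[OF b] by blast
      show "AE x in M. x \<in> S \<inter> A b \<longrightarrow> a x = 0" if "a \<in> B - {b}" for a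
      proof -
        have "disjoint_supports M a b"
          using B b that by (auto simp: disjoint_set_def pairwise_def)
        then show ?thesis
          unfolding disjoint_supports_def by eventually_elim (auto simp: A_def)
      qed
    qed auto
  qed
qed

text \<open>The families \<open>B n\<close> are disjoint from each other: a later family is supported in a set on
  which the members of the earlier ones vanish.\<close>

lemma bad_sequence:
  assumes "\<not> uniformly_trivial (space M)"
  shows "\<exists>S B. \<forall>n::nat. disjoint_set (S n) (B n) \<and> \<not> trivial_family (real n) (B n) (\<lambda>b. b) \<and>
    S (Suc n) \<subseteq> S n \<and> (\<forall>b\<in>B n. AE x in M. x \<in> S (Suc n) \<longrightarrow> b x = 0)"
proof -
  define step where "step n = (\<lambda>(S, B, S'). S' \<in> sets M \<and> \<not> uniformly_trivial S' \<and> S' \<subseteq> S \<and> disjoint_set S B \<and>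
    \<not> trivial_family (real n) B (\<lambda>b. b) \<and> (\<forall>b\<in>B. AE x in M. x \<in> S' \<longrightarrow> b x = 0))" for n
  have ex: "\<exists>B S'. step n (S, B, S')" if S: "S \<in> sets M" "\<not> uniformly_trivial S" for S n
  proof -
    obtain B S' where "disjoint_set S B" "\<not> trivial_family (real n) B (\<lambda>b. b)"
      "S' \<in> sets M" "S' \<subseteq> S" "\<not> uniformly_trivial S'" "\<And>b. b \<in> B \<Longrightarrow> AE x in M. x \<in> S' \<longrightarrow> b x = 0"
      using hump_step[OF S, of "real n"] by auto
    then show ?thesis unfolding step_def split_conv by blast
  qed
  have "\<exists>f. \<forall>n. step n (f n) \<and> fst (f (Suc n)) = snd (snd (f n))"
  proof (rule dependent_nat_choice)
    show "\<exists>t. step 0 t" using ex[OF _ assms] by blast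
  next
    fix t n assume "step n t"
    then have "snd (snd t) \<in> sets M" "\<not> uniformly_trivial (snd (snd t))" by (auto simp: step_def)
    from ex[OF this, of "Suc n"] show "\<exists>t'. step (Suc n) t' \<and> fst t' = snd (snd t)" by force
  qed
  then obtain f where f: "\<And>n. step n (f n)" "\<And>n. fst (f (Suc n)) = snd (snd (f n))" by blast
  show ?thesis
  proof (intro exI[of _ "\<lambda>n. fst (f n)"] exI[of _ "\<lambda>n. fst (snd (f n))"] allI)
    fix n
    show "disjoint_set (fst (f n)) (fst (snd (f n))) \<and>
      \<not> trivial_family (real n) (fst (snd (f n))) (\<lambda>b. b) \<and> fst (f (Suc n)) \<subseteq> fst (f n) \<and>
      (\<forall>b\<in>fst (snd (f n)). AE x in M. x \<in> fst (f (Suc n)) \<longrightarrow> b x = 0)"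
      using f(1)[of n] f(2)[of n] by (auto simp: step_def split_beta)
  qed
qed

text \<open>The gliding hump: a linear map close to \<open>\<Omega>\<close> on the closed span of all the families \<open>B n\<close> would
  provide a single bound for each of them.\<close>

lemma disjointly_trivial_imp_locally:
  assumes triv: "disjointly_trivial M K N sY \<Omega>"
  shows "locally_disjointly_trivial M K N sY \<Omega>"
proof (cases "uniformly_trivial (space M)")
  case True
  then obtain C where C: "0 \<le> C" "\<And>B. disjoint_set (space M) B \<Longrightarrow> trivial_family C B (\<lambda>b. b)"
    using uniformly_trivialE by blast
  have "trivial_family (C + 1) B (\<lambda>b. b)"
    if "finite B" "B \<subseteq> K" "pairwise (disjoint_supports M) B" for B
    using that by (intro trivial_family_mono[OF C(2)]) (auto simp: disjoint_set_def intro!: AE_I2)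
  then show ?thesis
    unfolding locally_disjointly_trivial_iff using C(1) by (intro exI[of _ "C + 1"]) auto
next
  case False
  from bad_sequence[OF False] obtain S B where SB: "\<forall>n::nat. disjoint_set (S n) (B n) \<and>
      \<not> trivial_family (real n) (B n) (\<lambda>b. b) \<and> S (Suc n) \<subseteq> S n \<and>
      (\<forall>b\<in>B n. AE x in M. x \<in> S (Suc n) \<longrightarrow> b x = 0)"
    by (elim exE)
  have B: "disjoint_set (S n) (B n)" and B_bad: "\<not> trivial_family (real n) (B n) (\<lambda>b. b)"
    and S: "S (Suc n) \<subseteq> S n" "b \<in> B n \<Longrightarrow> AE x in M. x \<in> S (Suc n) \<longrightarrow> b x = 0" for n b
    using SB by auto
  define U where "U = (\<Union>n. B n)"
  have "finite (B n)" and "B n \<subseteq> K" for n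
    using B[of n] by (simp_all add: disjoint_set_def)
  then have U_K: "U \<subseteq> K" and "countable U"
    unfolding U_def by (blast, simp add: countable_finite)
  have less: "disjoint_supports M a b" if "m < n" "a \<in> B m" "b \<in> B n" for m n a b
  proof -
    have "S n \<subseteq> S (Suc m)"
      using lift_Suc_antimono_le[of S, OF S(1)] that(1) by (simp add: Suc_le_eq)
    moreover have "AE x in M. x \<notin> S n \<longrightarrow> b x = 0"
      using B[of n] that by (auto simp: disjoint_set_def)
    ultimately show ?thesis
      using S(2)[OF that(2)] unfolding disjoint_supports_def by (auto elim: eventually_elim2)
  qed
  have U_disjoint: "disjoint_supports M a b" if ab: "a \<in> U" "b \<in> U" "a \<noteq> b" for a b
  proof -
    obtain m n where mn: "a \<in> B m" "b \<in> B n" using ab by (auto simp: U_def)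
    consider "m < n" | "n < m" | "m = n" by linarith
    then show ?thesis
    proof cases
      case 3
      then show ?thesis using B[of m] mn ab(3) by (auto simp: disjoint_set_def pairwise_def)
    qed (use less mn disjoint_supports_sym in blast)+
  qed
  \<comment> \<open>An injective enumeration, since a repeated vector is not disjoint from itself; indices outside
    the range of the enumeration yield zero.\<close>
  obtain e :: "_ \<Rightarrow> nat" where e: "inj_on e U"
    using \<open>countable U\<close> by (auto simp: countable_def)
  define u where "u k = (if k \<in> e ` U then inv_into U e k else 0)" for k
  have u: "u k = 0 \<or> u k \<in> U \<and> e (u k) = k" for k
    by (auto simp: u_def f_inv_into_f inv_into_into)
  have "u (e b) = b" if "b \<in> U" for b
    using that e by (simp add: u_def)
  then have U_range: "U \<subseteq> range u" by (metis rangeI subsetI)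
  have "u n \<in> K" for n
    using u[of n] U_K K_zero by auto
  moreover have "disjoint_supports M (u m) (u n)" if "m \<noteq> n" for m n
  proof (cases "u m = 0 \<or> u n = 0")
    case True
    then show ?thesis by (auto simp: disjoint_supports_def)
  next
    case False
    then show ?thesis using u[of m] u[of n] that by (intro U_disjoint) auto
  qed
  ultimately have triv_u: "trivial_on (closed_span K N (range u)) N sY \<Omega>" and u_K: "range u \<subseteq> K"
    using triv by (auto simp: disjointly_trivial_def)
  let ?X = "fvec.span (range u)"
  have X: "fvec.subspace ?X" "?X \<subseteq> K"
    using span_subset_K[OF u_K] by auto
  have sub: "?X \<subseteq> closed_span K N (range u)"
  proof
    fix f assume f: "f \<in> ?X"
    have "N (f - f) = 0" using N_zero by (simp del: zero_fun_apply)
    then show "f \<in> closed_span K N (range u)"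
      using f X(2) unfolding closed_span_def by (auto intro!: bexI[of _ f])
  qed
  have "trivial_on ?X N sY \<Omega>"
    using triv_u sub by (rule trivial_on_subset)
  then obtain L C where L: "linear_on fscale ?X sY L" "\<And>f. f \<in> ?X \<Longrightarrow> norm (\<Omega> f - L f) \<le> C * N f"
    unfolding trivial_on_iff[OF X] by blast
  obtain n :: nat where n: "C \<le> real n" using real_arch_simple by blast
  have "B n \<subseteq> ?X"
    using U_range unfolding U_def by (auto intro: fvec.span_base)
  then have "trivial_family C (B n) (\<lambda>b. b)"
    by (intro trivial_family_of_linear[OF X(1) L]) auto
  then have "trivial_family (real n) (B n) (\<lambda>b. b)"
    using n by (rule trivial_family_mono) (use B[of n] in \<open>auto simp: disjoint_set_def\<close>)
  then show ?thesis using B_bad by blast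
qed

end

section \<open>From disjoint families to arbitrary finite families\<close>

text \<open>Since the unit ball is totally bounded, every point can be rounded to one of finitely many centres;
  the centres are tried in a fixed order to make the choice measurable.\<close>

lemma finite_valued_approximation:
  fixes \<epsilon> :: real
  assumes "0 < \<epsilon>"
  obtains q :: "'k::euclidean_space \<Rightarrow> 'k" where "q \<in> borel_measurable borel" "finite (range q)"
    and "\<And>t. norm t \<le> 1 \<Longrightarrow> norm (t - q t) \<le> \<epsilon>"
proof -
  have *: "\<exists>q :: 'k \<Rightarrow> 'k. q \<in> borel_measurable borel \<and> finite (range q) \<and>
      (\<forall>t\<in>\<Union>z\<in>A. ball z \<epsilon>. norm (t - q t) \<le> \<epsilon>)" if "finite A" for A :: "'k set"
    using that
  proof induction
    case empty
    show ?case by (intro exI[of _ "\<lambda>_. 0"]) auto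
  next
    case (insert z A)
    then obtain q :: "'k \<Rightarrow> 'k" where q: "q \<in> borel_measurable borel" "finite (range q)"
      "\<forall>t\<in>\<Union>z\<in>A. ball z \<epsilon>. norm (t - q t) \<le> \<epsilon>" by blast
    let ?q = "\<lambda>t. if t \<in> ball z \<epsilon> then z else q t"
    have "?q \<in> borel_measurable borel"
      using q(1) by (intro measurable_If_set) auto
    moreover have "finite (range ?q)"
      by (rule finite_subset[of _ "insert z (range q)"]) (use q(2) in auto)
    moreover have "\<forall>t\<in>\<Union>z\<in>insert z A. ball z \<epsilon>. norm (t - ?q t) \<le> \<epsilon>"
      using q(3) by (auto simp: dist_norm norm_minus_commute less_imp_le)
    ultimately show ?case by blast
  qed
  obtain A :: "'k set" where "finite A" "cball 0 1 \<subseteq> (\<Union>z\<in>A. ball z \<epsilon>)"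
  proof (rule compactE_image[OF compact_cball[of "0::'k" 1], of UNIV "\<lambda>z. ball z \<epsilon>"])
    show "cball 0 1 \<subseteq> (\<Union>z. ball z \<epsilon>)"
      using assms by (auto intro: centre_in_ball[THEN iffD2])
  qed auto
  moreover obtain q :: "'k \<Rightarrow> 'k" where "q \<in> borel_measurable borel" "finite (range q)"
      "\<forall>t\<in>\<Union>z\<in>A. ball z \<epsilon>. norm (t - q t) \<le> \<epsilon>"
    using *[OF \<open>finite A\<close>] by blast
  ultimately show thesis
    by (intro that[of q]) (force simp: subset_eq)+
qed

lemma bounded_families_convergent_subsequence:
  fixes c :: "nat \<Rightarrow> 'i \<Rightarrow> 'k::heine_borel"
  assumes "finite I" "\<And>i. i \<in> I \<Longrightarrow> bounded (range (\<lambda>n. c n i))"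
  obtains r :: "nat \<Rightarrow> nat" and l where "strict_mono r" "\<And>i. i \<in> I \<Longrightarrow> (\<lambda>n. c (r n) i) \<longlonglongrightarrow> l i"
proof -
  have "\<exists>(r :: nat \<Rightarrow> nat) l. strict_mono r \<and> (\<forall>i\<in>I. (\<lambda>n. c (r n) i) \<longlonglongrightarrow> l i)"
    using assms
  proof induction
    case empty
    show ?case by (intro exI[of _ id]) (auto simp: strict_mono_def)
  next
    case (insert j I)
    then obtain r :: "nat \<Rightarrow> nat" and l where r: "strict_mono r" "\<forall>i\<in>I. (\<lambda>n. c (r n) i) \<longlonglongrightarrow> l i"
      by auto
    have "bounded (range (\<lambda>n. c (r n) j))"
      by (rule bounded_subset[OF insert.prems[of j]]) auto
    then obtain a s where s: "strict_mono s" "((\<lambda>n. c (r n) j) \<circ> s) \<longlonglongrightarrow> a"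
      using bounded_imp_convergent_subsequence by blast
    have "(\<lambda>n. c ((r \<circ> s) n) i) \<longlonglongrightarrow> (if i = j then a else l i)" if "i \<in> insert j I" for i
      using that s r LIMSEQ_subseq_LIMSEQ[OF _ s(1), of "\<lambda>n. c (r n) i" "l i"] by (auto simp: o_def)
    then show ?case
      using strict_mono_o[OF r(1) s(1)]
      by (intro exI[of _ "r \<circ> s"] exI[of _ "\<lambda>i. if i = j then a else l i"] conjI ballI)
  qed
  then obtain r :: "nat \<Rightarrow> nat" and l
    where "strict_mono r" "\<forall>i\<in>I. (\<lambda>n. c (r n) i) \<longlonglongrightarrow> l i"
    by (elim exE conjE)
  then show thesis by (intro that[of r l]) simp_all
qed

context quasi_linear_map
begin

text \<open>The inequalities for two summands are iterated.  The constant \<open>D\<close> is chosen before the functions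
  \<open>u\<close>, so that these may be taken small relative to it.\<close>

lemma finite_sum_bounds:
  assumes "finite I"
  obtains D where "0 \<le> D"
    and "\<And>c u. (\<And>i. i \<in> I \<Longrightarrow> u i \<in> K) \<Longrightarrow> N (combination I c u) \<le> D * (\<Sum>i\<in>I. norm (c i) * N (u i))"
    and "\<And>c u. (\<And>i. i \<in> I \<Longrightarrow> u i \<in> K) \<Longrightarrow>
      norm (\<Omega> (combination I c u) - (\<Sum>i\<in>I. sY (c i) (\<Omega> (u i)))) \<le> D * (\<Sum>i\<in>I. norm (c i) * N (u i))"
proof -
  have "\<exists>D\<ge>0. \<forall>c u. (\<forall>i\<in>I. u i \<in> K) \<longrightarrow>
      N (combination I c u) \<le> D * (\<Sum>i\<in>I. norm (c i) * N (u i)) \<and>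
      norm (\<Omega> (combination I c u) - (\<Sum>i\<in>I. sY (c i) (\<Omega> (u i)))) \<le> D * (\<Sum>i\<in>I. norm (c i) * N (u i))"
    using assms
  proof induction
    case empty
    show ?case using N_zero \<Omega>_zero by (intro exI[of _ 0]) (auto simp del: zero_fun_apply)
  next
    case (insert j I)
    then obtain D where D: "0 \<le> D" and IH: "\<And>c u. (\<forall>i\<in>I. u i \<in> K) \<Longrightarrow>
        N (combination I c u) \<le> D * (\<Sum>i\<in>I. norm (c i) * N (u i)) \<and>
        norm (\<Omega> (combination I c u) - (\<Sum>i\<in>I. sY (c i) (\<Omega> (u i)))) \<le> D * (\<Sum>i\<in>I. norm (c i) * N (u i))"
      by blast
    define E where "E = Q * (1 + D) + Z * (1 + D) + D"
    have "N (combination (insert j I) c u) \<le> E * (\<Sum>i\<in>insert j I. norm (c i) * N (u i)) \<and>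
        norm (\<Omega> (combination (insert j I) c u) - (\<Sum>i\<in>insert j I. sY (c i) (\<Omega> (u i))))
          \<le> E * (\<Sum>i\<in>insert j I. norm (c i) * N (u i))" if u: "\<forall>i\<in>insert j I. u i \<in> K" for c u
    proof -
      let ?f = "fscale (c j) (u j)" and ?g = "combination I c u"
      let ?t = "norm (c j) * N (u j)" and ?s = "\<Sum>i\<in>I. norm (c i) * N (u i)"
      have K: "?f \<in> K" "?g \<in> K" using u by (auto intro!: K_scale K_combination)
      have nn: "0 \<le> ?t" "0 \<le> ?s" using u N_nonneg by (auto intro!: sum_nonneg mult_nonneg_nonneg)
      have f: "N ?f = ?t" using u by (simp add: N_scale)
      have g: "N ?g \<le> D * ?s" and \<Omega>g: "norm (\<Omega> ?g - (\<Sum>i\<in>I. sY (c i) (\<Omega> (u i)))) \<le> D * ?s"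
        using IH[of u c] u by auto
      have "D * ?t \<ge> 0" "D * ?s \<ge> 0" using D nn by auto
      then have fg: "N ?f + N ?g \<le> (1 + D) * (?t + ?s)"
        using f g nn by (simp add: algebra_simps)
      have pos: "0 \<le> Q * ((1 + D) * (?t + ?s))" "0 \<le> Z * ((1 + D) * (?t + ?s))" "0 \<le> D * (?t + ?s)"
        using Q_ge_1 Z_nonneg D nn by auto
      have E: "E * (?t + ?s) = Q * ((1 + D) * (?t + ?s)) + Z * ((1 + D) * (?t + ?s)) + D * (?t + ?s)"
        by (simp add: E_def algebra_simps)
      have "N (?f + ?g) \<le> Q * ((1 + D) * (?t + ?s))"
        using N_add[OF K] mult_left_mono[OF fg, of Q] Q_ge_1 by linarith
      then have 1: "N (?f + ?g) \<le> E * (?t + ?s)" using E pos by linarith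
      have "norm (\<Omega> (?f + ?g) - (\<Omega> ?f + (\<Sum>i\<in>I. sY (c i) (\<Omega> (u i))))) =
          norm ((\<Omega> (?f + ?g) - \<Omega> ?f - \<Omega> ?g) + (\<Omega> ?g - (\<Sum>i\<in>I. sY (c i) (\<Omega> (u i)))))"
        by (simp add: algebra_simps)
      also have "\<dots> \<le> Z * (N ?f + N ?g) + D * ?s"
        by (rule norm_triangle_le[OF add_mono[OF \<Omega>_add[OF K] \<Omega>g]])
      also have "\<dots> \<le> Z * ((1 + D) * (?t + ?s)) + D * (?t + ?s)"
        using fg Z_nonneg D nn by (intro add_mono mult_left_mono) auto
      also have "\<dots> \<le> E * (?t + ?s)" using E pos by linarith
      finally show ?thesis
        using 1 insert.hyps u by (simp add: \<Omega>_scale del: plus_fun_apply)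
    qed
    moreover have "0 \<le> E" using D Q_ge_1 Z_nonneg by (simp add: E_def)
    ultimately show ?case by blast
  qed
  then show thesis using that by blast
qed

text \<open>On the span of functions that are linearly independent modulo null functions, the quasi-norm
  dominates the coefficients, by compactness of the unit sphere of the coefficient space.  Otherwise there are combinations with coefficients of total size one
  and quasi-norms tending to zero; a limit of their coefficients yields a null function.  The
  quasi-norm is possibly discontinuous, but the quasi-triangle inequality suffices.\<close>

lemma independent_coefficient_bound:
  assumes I: "finite I" and u: "\<And>i. i \<in> I \<Longrightarrow> u i \<in> K"
    and indep: "\<And>c. AE x in M. combination I c u x = 0 \<Longrightarrow> \<forall>i\<in>I. c i = 0"
  obtains \<kappa> where "0 \<le> \<kappa>" "\<And>c. (\<Sum>i\<in>I. norm (c i)) \<le> \<kappa> * N (combination I c u)"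
proof (rule ccontr)
  note thesis_rule = that
  assume no: "\<not> thesis"
  have K: "combination I c u \<in> K" for c using u by (rule K_combination)
  have large: "\<exists>c. \<kappa> * N (combination I c u) < (\<Sum>i\<in>I. norm (c i))" if "0 \<le> \<kappa>" for \<kappa>
    using no thesis_rule[OF that] by (meson not_le)
  have "\<exists>c. (\<Sum>i\<in>I. norm (c i)) = 1 \<and> N (combination I c u) \<le> 1 / real (Suc n)" for n
  proof -
    obtain c where c: "real (Suc n) * N (combination I c u) < (\<Sum>i\<in>I. norm (c i))"
      using large[of "real (Suc n)"] by auto
    define s where "s = (\<Sum>i\<in>I. norm (c i))"
    have "s > 0"
      using c N_nonneg[OF K, of c] mult_nonneg_nonneg[of "real (Suc n)" "N (combination I c u)"]
      unfolding s_def by linarith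
    define d where "d i = of_real (inverse s) * c i" for i
    have "combination I d u = fscale (of_real (inverse s)) (combination I c u)"
      by (simp add: d_def fvec.scale_sum_right)
    then have "N (combination I d u) = inverse s * N (combination I c u)"
      using \<open>s > 0\<close> by (simp add: N_scale[OF K] norm_inverse del: of_real_inverse)
    also have "\<dots> \<le> 1 / real (Suc n)"
      using c \<open>s > 0\<close> by (simp add: s_def[symmetric] field_simps)
    finally have "N (combination I d u) \<le> 1 / real (Suc n)" .
    moreover have "(\<Sum>i\<in>I. norm (d i)) = inverse s * s"
      using \<open>s > 0\<close> unfolding s_def d_def by (simp add: norm_mult sum_distrib_left del: of_real_inverse)
    ultimately show ?thesis using \<open>s > 0\<close> by (intro exI[of _ d]) simp
  qed
  then obtain c where c: "\<And>n. (\<Sum>i\<in>I. norm (c n i)) = 1"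
    and Nc: "\<And>n. N (combination I (c n) u) \<le> 1 / real (Suc n)" by metis
  have "bounded (range (\<lambda>n. c n i))" if "i \<in> I" for i
  proof -
    have "norm (c n i) \<le> 1" for n
      using member_le_sum[of i I "\<lambda>i. norm (c n i)"] c[of n] that I by simp
    then show ?thesis by (auto simp: bounded_iff)
  qed
  then obtain r l where r: "strict_mono r" and l: "\<And>i. i \<in> I \<Longrightarrow> (\<lambda>n. c (r n) i) \<longlonglongrightarrow> l i"
    using bounded_families_convergent_subsequence[OF I, of c] by metis
  obtain D where D: "0 \<le> D"
      "\<And>c u. (\<And>i. i \<in> I \<Longrightarrow> u i \<in> K) \<Longrightarrow> N (combination I c u) \<le> D * (\<Sum>i\<in>I. norm (c i) * N (u i))"
    using finite_sum_bounds[OF I] by metis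
  let ?b = "\<lambda>n. Q * (D * (\<Sum>i\<in>I. norm (l i - c (r n) i) * N (u i)) + 1 / real (Suc (r n)))"
  have "N (combination I l u) \<le> ?b n" for n
  proof -
    have "combination I l u = combination I (\<lambda>i. l i - c (r n) i) u + combination I (c (r n)) u"
      by (simp add: fvec.scale_left_diff_distrib sum_subtractf)
    then have "N (combination I l u) \<le>
        Q * (N (combination I (\<lambda>i. l i - c (r n) i) u) + N (combination I (c (r n)) u))"
      using N_add[OF K[of "\<lambda>i. l i - c (r n) i"] K[of "c (r n)"]] by (simp only:)
    also have "\<dots> \<le> ?b n"
      using Q_ge_1 by (intro mult_left_mono add_mono D(2) Nc u) auto
    finally show ?thesis .
  qed
  moreover have "?b \<longlonglongrightarrow> Q * (D * (\<Sum>i\<in>I. norm (l i - l i) * N (u i)) + 0)"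
  proof (intro tendsto_intros l)
    show "(\<lambda>n. 1 / real (Suc (r n))) \<longlonglongrightarrow> 0"
      using LIMSEQ_subseq_LIMSEQ[OF LIMSEQ_Suc[OF lim_1_over_n] r] by (simp add: o_def)
  qed
  ultimately have "N (combination I l u) \<le> 0"
    using LIMSEQ_le_const[of ?b _ "N (combination I l u)"] by simp
  then have "N (combination I l u) = 0" using N_nonneg[OF K, of l] by linarith
  then have "\<forall>i\<in>I. l i = 0" using N_null[OF K] indep by blast
  moreover have "(\<lambda>n. \<Sum>i\<in>I. norm (c (r n) i)) \<longlonglongrightarrow> (\<Sum>i\<in>I. norm (l i))"
    by (intro tendsto_intros l)
  ultimately show False
    using c LIMSEQ_unique[OF tendsto_const[of "1::real"]] by fastforce
qed

text \<open>Finitely many functions are, up to functions of arbitrarily small quasi-norm, combinations of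
  disjointly supported functions.  Simple functions need not be dense in \<open>K\<close>, but each of the
  given functions is the product of a function bounded by one, which is uniformly close to a finite-valued
  function, and of the sum \<open>g\<close> of their absolute values; the disjointly supported functions are
  restrictions of \<open>g\<close> to level sets.\<close>

lemma disjoint_approximation:
  assumes B: "finite B" "B \<subseteq> K" and \<epsilon>: "0 < \<epsilon>"
  obtains W T where "finite W" "W \<subseteq> K" "pairwise (disjoint_supports M) W"
    and "T ` B \<subseteq> fvec.span W" "\<And>b. b \<in> B \<Longrightarrow> N (b - T b) \<le> \<epsilon>"
proof -
  define g :: "'a \<Rightarrow> 'k" where "g = (\<Sum>b\<in>B. (\<lambda>x. of_real (norm (b x))))"
  have abs_K: "(\<lambda>x. of_real (norm (b x)) :: 'k) \<in> K" if "b \<in> B" for b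
  proof (rule K_dominated(1)[of _ b])
    show "b \<in> K" using that B by blast
    from K_measurable[OF this] show "(\<lambda>x. of_real (norm (b x)) :: 'k) \<in> borel_measurable M"
      by measurable
  qed simp
  then have gK: "g \<in> K" unfolding g_def by (intro fvec.subspace_sum[OF K_subspace])
  have [measurable]: "g \<in> borel_measurable M" using gK by (rule K_measurable)
  have B_meas [measurable]: "b \<in> borel_measurable M" if "b \<in> B" for b
    using that B K_measurable by blast
  have g: "g x = of_real (\<Sum>b\<in>B. norm (b x))" for x
    by (simp add: g_def sum_fun_apply)
  have le_g: "norm (b x) \<le> norm (g x)" if "b \<in> B" for b x
    unfolding g using that B(1) member_le_sum[of b B "\<lambda>b. norm (b x)"] by (simp add: sum_nonneg del: of_real_sum)
  define h where "h b x = b x / g x" for b x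
  have h: "b x = h b x * g x" "norm (h b x) \<le> 1" if "b \<in> B" for b x
    using le_g[OF that, of x] by (auto simp: h_def norm_divide divide_le_eq_1)
  have h_meas: "h b \<in> borel_measurable M" if "b \<in> B" for b
    unfolding h_def using B_meas[OF that] by measurable
  define \<delta> where "\<delta> = \<epsilon> / (N g + 1)"
  have "0 \<le> N g" by (rule N_nonneg[OF gK])
  then have "0 < \<delta>" and \<delta>: "\<delta> * N g \<le> \<epsilon>"
    using \<epsilon> by (auto simp: \<delta>_def field_simps)
  obtain q :: "'k \<Rightarrow> 'k" where q: "q \<in> borel_measurable borel" "finite (range q)"
    "\<And>t. norm t \<le> 1 \<Longrightarrow> norm (t - q t) \<le> \<delta>"
    using finite_valued_approximation[OF \<open>0 < \<delta>\<close>] by blast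
  have qh_meas: "(\<lambda>x. q (h b x)) \<in> borel_measurable M" if "b \<in> B" for b
    using measurable_compose[OF h_meas[OF that] q(1)] .
  define V where "V = (\<Pi>\<^sub>E b\<in>B. range q)"
  define S where "S v = {x \<in> space M. \<forall>b\<in>B. q (h b x) = v b}" for v
  have "finite V" unfolding V_def using B(1) q(2) by (intro finite_PiE)
  have S: "S v \<in> sets M" for v
  proof -
    have "{x \<in> space M. q (h b x) = v b} \<in> sets M" if "b \<in> B" for b
      using qh_meas[OF that] by measurable
    then show ?thesis unfolding S_def using B(1) by (rule sets.sets_Collect_finite_All)
  qed
  define w where "w v = cutoff (S v) g" for v
  have wK: "w v \<in> K" for v
    unfolding w_def using cutoff_K(1)[OF gK] S sets.Int_space_eq2 by metis
  define T where "T b = combination V (\<lambda>v. v b) w" for b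
  have T: "T b x = q (h b x) * g x" if b: "b \<in> B" and x: "x \<in> space M" for b x
  proof -
    let ?v = "\<lambda>b\<in>B. q (h b x)"
    have "?v \<in> V" by (auto simp: V_def)
    have "x \<notin> S v" if "v \<in> V" "v \<noteq> ?v" for v
    proof
      assume "x \<in> S v"
      then have "v = ?v" using that(1) by (intro PiE_ext[of v B "\<lambda>_. range q"]) (auto simp: V_def S_def)
      then show False using that(2) by simp
    qed
    then have "T b x = (\<Sum>v\<in>V. if v = ?v then v b * g x else 0)"
      using x unfolding T_def combination_apply w_def cutoff_def
      by (intro sum.cong) (auto simp: S_def)
    also have "\<dots> = q (h b x) * g x" using \<open>finite V\<close> \<open>?v \<in> V\<close> b by (simp add: sum.delta)
    finally show ?thesis .
  qed
  show thesis
  proof (rule that[of "w ` V" T])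
    show "finite (w ` V)" "w ` V \<subseteq> K" using \<open>finite V\<close> wK by auto
    show "pairwise (disjoint_supports M) (w ` V)"
    proof (rule pairwiseI)
      fix a a' assume "a \<in> w ` V" "a' \<in> w ` V" "a \<noteq> a'"
      then obtain v v' where v: "a = w v" "a' = w v'" "v \<in> V" "v' \<in> V" "v \<noteq> v'" by blast
      then obtain b where "b \<in> B" "v b \<noteq> v' b"
        unfolding V_def by (metis PiE_ext)
      then have "x \<notin> S v \<or> x \<notin> S v'" for x
        unfolding S_def by (metis (mono_tags, lifting) mem_Collect_eq)
      then show "disjoint_supports M a a'"
        unfolding disjoint_supports_def v w_def cutoff_def by (intro AE_I2) auto
    qed
    show "T ` B \<subseteq> fvec.span (w ` V)"
      unfolding T_def by (intro image_subsetI fvec.span_sum fvec.span_scale fvec.span_base imageI)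
    fix b assume b: "b \<in> B"
    have "b - T b \<in> K"
      unfolding T_def using b B(2) wK by (intro K_diff K_combination) auto
    moreover have "AE x in M. norm ((b - T b) x) \<le> norm (fscale (of_real \<delta>) g x)"
    proof (rule AE_I2)
      fix x assume "x \<in> space M"
      then have "(b - T b) x = (h b x - q (h b x)) * g x"
        using T[OF b] h(1)[OF b, of x] by (simp add: algebra_simps)
      then have "norm ((b - T b) x) = norm (h b x - q (h b x)) * norm (g x)"
        by (simp only: norm_mult)
      also have "\<dots> \<le> \<delta> * norm (g x)"
        using q(3)[OF h(2)[OF b]] by (intro mult_right_mono) auto
      finally show "norm ((b - T b) x) \<le> norm (fscale (of_real \<delta>) g x)"
        using \<open>0 < \<delta>\<close> by (simp add: fscale_apply norm_mult)
    qed
    ultimately have "N (b - T b) \<le> N (fscale (of_real \<delta>) g)"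
      using K_dominated(2)[OF K_measurable K_scale[OF gK]] by blast
    then show "N (b - T b) \<le> \<epsilon>"
      using \<delta> \<open>0 < \<delta>\<close> by (simp add: N_scale[OF gK])
  qed
qed

text \<open>The resulting constant depends on \<open>C\<close>, \<open>Q\<close> and \<open>Z\<close> only: the constants \<open>D\<close> and \<open>\<kappa>\<close> of the particular
  finite-dimensional space are absorbed by the error \<open>\<epsilon>\<close> of the approximation by combinations of
  disjointly supported functions, which is chosen after them.\<close>

lemma trivial_family_independent:
  assumes B: "finite B" "B \<subseteq> K" and C: "0 \<le> C"
    and indep: "\<And>c. AE x in M. combination B c (\<lambda>b. b) x = 0 \<Longrightarrow> \<forall>b\<in>B. c b = 0"
    and disj: "\<And>W. finite W \<Longrightarrow> W \<subseteq> K \<Longrightarrow> pairwise (disjoint_supports M) W \<Longrightarrow>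
      trivial_family C W (\<lambda>w. w)"
  shows "trivial_family (2 * C * Q + 1 + Z * (2 * Q + 1)) B (\<lambda>b. b)"
proof -
  have BK: "b \<in> K" if "b \<in> B" for b using that B by blast
  obtain \<kappa> where \<kappa>: "0 \<le> \<kappa>" "\<And>c. (\<Sum>b\<in>B. norm (c b)) \<le> \<kappa> * N (combination B c (\<lambda>b. b))"
    using independent_coefficient_bound[of B "\<lambda>b. b", OF B(1) BK indep] by blast
  obtain D where D: "0 \<le> D"
    "\<And>c u. (\<And>b. b \<in> B \<Longrightarrow> u b \<in> K) \<Longrightarrow> N (combination B c u) \<le> D * (\<Sum>b\<in>B. norm (c b) * N (u b))"
    "\<And>c u. (\<And>b. b \<in> B \<Longrightarrow> u b \<in> K) \<Longrightarrow>
      norm (\<Omega> (combination B c u) - (\<Sum>b\<in>B. sY (c b) (\<Omega> (u b)))) \<le> D * (\<Sum>b\<in>B. norm (c b) * N (u b))"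
    using finite_sum_bounds[OF B(1)] by blast
  define \<epsilon> where "\<epsilon> = 1 / (D * \<kappa> + 1)"
  have "0 \<le> D * \<kappa>" using D(1) \<kappa>(1) by simp
  then have "0 < \<epsilon>" and \<epsilon>: "D * \<kappa> * \<epsilon> \<le> 1" by (auto simp: \<epsilon>_def field_simps)
  obtain W T where W: "finite W" "W \<subseteq> K" "pairwise (disjoint_supports M) W"
    and T: "T ` B \<subseteq> fvec.span W" and small: "\<And>b. b \<in> B \<Longrightarrow> N (b - T b) \<le> \<epsilon>"
    using disjoint_approximation[OF B \<open>0 < \<epsilon>\<close>] by metis
  have TK: "T b \<in> K" if "b \<in> B" for b using T span_subset_K[OF W(2)] that by blast
  let ?e = "\<lambda>b. b - T b"
  have eK: "?e b \<in> K" if "b \<in> B" for b using that BK TK by (intro K_diff)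
  obtain L where L: "linear_on fscale (fvec.span W) sY L"
    "\<And>f. f \<in> fvec.span W \<Longrightarrow> norm (\<Omega> f - L f) \<le> C * N f"
    using linear_of_trivial_family[OF W(1,2) disj[OF W]] by blast
  have u: "nearly_linear B T (\<lambda>c. C * N (combination B c T))"
    using trivial_family_of_linear[OF fvec.subspace_span L T] unfolding trivial_family_def .
  have v: "nearly_linear B ?e (\<lambda>c. D * (\<Sum>b\<in>B. norm (c b) * N (?e b)))"
    unfolding nearly_linear_def using D(3)[of ?e] eK by (intro exI[of _ "\<lambda>b. \<Omega> (?e b)"]) blast
  have "nearly_linear B (\<lambda>b. T b + ?e b) (\<lambda>c. C * N (combination B c T) +
      D * (\<Sum>b\<in>B. norm (c b) * N (?e b)) + Z * (N (combination B c T) + N (combination B c ?e)))"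
    by (rule nearly_linear_add[OF u TK v eK])
  then show ?thesis
    unfolding trivial_family_def add_diff_cancel_left' add_diff_eq
  proof (rule nearly_linear_mono)
    fix c
    let ?f = "combination B c (\<lambda>b. b)"
    have K: "?f \<in> K" "combination B c T \<in> K" "combination B c ?e \<in> K"
      using BK TK eK by (auto intro: K_combination)
    have "(\<Sum>b\<in>B. norm (c b) * N (?e b)) \<le> (\<Sum>b\<in>B. norm (c b)) * \<epsilon>"
      unfolding sum_distrib_right using small by (intro sum_mono mult_left_mono) auto
    also have "\<dots> \<le> \<kappa> * N ?f * \<epsilon>"
      using \<kappa>(2)[of c] \<open>0 < \<epsilon>\<close> by (intro mult_right_mono) auto
    finally have "D * (\<Sum>b\<in>B. norm (c b) * N (?e b)) \<le> D * (\<kappa> * N ?f * \<epsilon>)"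
      using D(1) by (rule mult_left_mono)
    also have "\<dots> = (D * \<kappa> * \<epsilon>) * N ?f" by simp
    also have "\<dots> \<le> 1 * N ?f"
      using \<epsilon> N_nonneg[OF K(1)] by (rule mult_right_mono)
    finally have 1: "D * (\<Sum>b\<in>B. norm (c b) * N (?e b)) \<le> N ?f" by simp
    then have e: "N (combination B c ?e) \<le> N ?f"
      using D(2)[of ?e c] eK by force
    have "combination B c T = ?f + fscale (-1) (combination B c ?e)"
      by (simp add: fvec.scale_right_diff_distrib sum_subtractf fvec.scale_minus_left)
    then have "N (combination B c T) \<le> Q * (N ?f + N (fscale (-1) (combination B c ?e)))"
      using N_add[OF K(1) K_scale[OF K(3), of "-1"]] by (simp only:)
    also have "\<dots> \<le> Q * (N ?f + N ?f)"
      unfolding N_scale[OF K(3)] using e Q_ge_1 by (intro mult_left_mono) auto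
    finally have T: "N (combination B c T) \<le> 2 * Q * N ?f" by simp
    have "C * N (combination B c T) \<le> C * (2 * Q * N ?f)"
      using T C by (rule mult_left_mono)
    moreover have "Z * (N (combination B c T) + N (combination B c ?e)) \<le> Z * (2 * Q * N ?f + N ?f)"
      using T e Z_nonneg by (intro mult_left_mono) auto
    ultimately show "C * N (combination B c T) + D * (\<Sum>b\<in>B. norm (c b) * N (?e b)) +
        Z * (N (combination B c T) + N (combination B c ?e))
        \<le> (2 * C * Q + 1 + Z * (2 * Q + 1)) * N ?f"
      using 1 by (simp add: algebra_simps)
  qed
qed

text \<open>Up to a null function, \<open>b\<close> is a combination of the other members.  It is sent to the
  same combination of their images; \<open>\<Omega>\<close> and the quasi-norm do not see null functions.\<close>

lemma trivial_family_dependent: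
  assumes B: "finite B" "B \<subseteq> K" and b: "b \<in> B"
    and null: "AE x in M. combination B a (\<lambda>b. b) x = 0" and "a b \<noteq> 0"
    and triv: "trivial_family C (B - {b}) (\<lambda>b. b)"
  shows "trivial_family C B (\<lambda>b. b)"
proof -
  obtain y where y: "\<And>c. norm (\<Omega> (combination (B - {b}) c (\<lambda>b. b)) - (\<Sum>b\<in>B - {b}. sY (c b) (y b)))
      \<le> C * N (combination (B - {b}) c (\<lambda>b. b))"
    using triv by (auto simp: trivial_family_def nearly_linear_def)
  define a' where "a' i = - a i / a b" for i
  define z where "z = y(b := \<Sum>i\<in>B - {b}. sY (a' i) (y i))"
  show ?thesis
    unfolding trivial_family_def nearly_linear_def
  proof (intro exI[of _ z] allI)
    fix c
    let ?c = "\<lambda>i. c i + c b * a' i"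
    have K: "combination B c (\<lambda>b. b) \<in> K" "combination (B - {b}) ?c (\<lambda>b. b) \<in> K"
      using B by (auto intro!: K_combination)
    have ae: "AE x in M. combination B c (\<lambda>b. b) x = combination (B - {b}) ?c (\<lambda>b. b) x"
      using null
    proof eventually_elim
      case (elim x)
      have "a b * b x + (\<Sum>i\<in>B - {b}. a i * i x) = 0"
        using elim unfolding combination_apply by (simp only: sum.remove[OF B(1) b])
      then have "b x = - (\<Sum>i\<in>B - {b}. a i * i x) / a b"
        using \<open>a b \<noteq> 0\<close> by (simp add: field_simps eq_neg_iff_add_eq_0 add.commute)
      also have "\<dots> = (\<Sum>i\<in>B - {b}. a' i * i x)"
        by (simp add: a'_def sum_negf sum_divide_distrib)
      finally have "c b * b x = (\<Sum>i\<in>B - {b}. c b * a' i * i x)"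
        by (simp add: sum_distrib_left mult.assoc)
      then show ?case
        using B(1) b unfolding combination_apply sum.remove[OF B(1) b]
        by (simp add: fscale_apply distrib_right sum.distrib)
    qed
    have "(\<Sum>i\<in>B. sY (c i) (z i)) = (\<Sum>i\<in>B - {b}. sY (?c i) (y i))"
      using B(1) b by (simp add: sum.remove[of B b] z_def y.scale_left_distrib sum.distrib
          y.scale_sum_right)
    then show "norm (\<Omega> (combination B c (\<lambda>b. b)) - (\<Sum>i\<in>B. sY (c i) (z i)))
        \<le> C * N (combination B c (\<lambda>b. b))"
      using y[of ?c] \<Omega>_AE_cong[OF K ae] N_AE_cong[OF K ae] by simp
  qed
qed

text \<open>Dependent members are removed one by one, which keeps the constant, until the rest is
  independent.\<close>

lemma locally_disjointly_trivial_imp_locally_trivial: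
  assumes "locally_disjointly_trivial M K N sY \<Omega>"
  shows "locally_trivial K N sY \<Omega>"
proof -
  obtain C where "0 < C" and disj: "\<And>W. finite W \<Longrightarrow> W \<subseteq> K \<Longrightarrow> pairwise (disjoint_supports M) W \<Longrightarrow>
      trivial_family C W (\<lambda>w. w)"
    using assms unfolding locally_disjointly_trivial_iff by blast
  let ?C = "2 * C * Q + 1 + Z * (2 * Q + 1)"
  have "trivial_family ?C B (\<lambda>b. b)" if "finite B" "B \<subseteq> K" for B
    using that
  proof (induction B rule: finite_psubset_induct)
    case (psubset B)
    show ?case
    proof (cases "\<exists>a b. b \<in> B \<and> a b \<noteq> 0 \<and> (AE x in M. combination B a (\<lambda>b. b) x = 0)")
      case True
      then obtain a b where ab: "b \<in> B" "a b \<noteq> 0" "AE x in M. combination B a (\<lambda>b. b) x = 0"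
        by blast
      then have "B - {b} \<subset> B" by blast
      moreover have "B - {b} \<subseteq> K" using psubset.prems by blast
      ultimately have "trivial_family ?C (B - {b}) (\<lambda>b. b)"
        by (rule psubset.IH)
      then show ?thesis
        by (rule trivial_family_dependent[OF psubset.hyps(1) psubset.prems ab(1,3,2)])
    next
      case False
      then show ?thesis
        using \<open>0 < C\<close> disj psubset by (intro trivial_family_independent) auto
    qed
  qed
  moreover have "0 < ?C"
    using \<open>0 < C\<close> Q_ge_1 Z_nonneg by (intro add_pos_nonneg) auto
  ultimately show ?thesis
    unfolding locally_trivial_iff by blast
qed

lemma locally_trivial_imp_locally_disjointly_trivial:
  "locally_trivial K N sY \<Omega> \<Longrightarrow> locally_disjointly_trivial M K N sY \<Omega>"
  unfolding locally_trivial_def locally_disjointly_trivial_def by blast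

lemma trivial_imp_disjointly_trivial:
  assumes "trivial_on K N sY \<Omega>"
  shows "disjointly_trivial M K N sY \<Omega>"
  unfolding disjointly_trivial_def
proof (intro allI impI)
  fix u :: "nat \<Rightarrow> 'a \<Rightarrow> 'k"
  show "trivial_on (closed_span K N (range u)) N sY \<Omega>"
    using assms by (rule trivial_on_subset) (auto simp: closed_span_def)
qed

end

section \<open>Dual spaces\<close>

lemma dual_add:
  assumes "\<phi> \<in> dual sV V N" "\<psi> \<in> dual sV V N"
  shows "\<phi> + \<psi> \<in> dual sV V N"
proof -
  obtain A B where AB: "\<forall>v\<in>V. norm (\<phi> v) \<le> A * N v" "\<forall>v\<in>V. norm (\<psi> v) \<le> B * N v"
    using assms unfolding dual_def by blast
  have "norm (\<phi> v + \<psi> v) \<le> (A + B) * N v" if "v \<in> V" for v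
    using norm_triangle_ineq[of "\<phi> v" "\<psi> v"] AB that by (fastforce simp: distrib_right)
  then have "\<exists>B. \<forall>v\<in>V. norm ((\<phi> + \<psi>) v) \<le> B * N v"
    by auto
  then show ?thesis
    using assms unfolding dual_def linear_on_def by (simp add: algebra_simps)
qed

lemma dual_scale:
  assumes "\<phi> \<in> dual sV V N"
  shows "fscale c \<phi> \<in> dual sV V N"
proof -
  obtain B where B: "\<forall>v\<in>V. norm (\<phi> v) \<le> B * N v"
    using assms unfolding dual_def by blast
  have "norm (c * \<phi> v) \<le> (norm c * B) * N v" if "v \<in> V" for v
    using mult_left_mono[of "norm (\<phi> v)" "B * N v" "norm c"] B that by (simp add: norm_mult mult.assoc)
  then have "\<exists>B. \<forall>v\<in>V. norm (fscale c \<phi> v) \<le> B * N v"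
    unfolding fscale_apply by blast
  then show ?thesis
    using assms unfolding dual_def linear_on_def by (simp add: algebra_simps fscale_apply)
qed

lemma zero_in_dual: "0 \<in> dual sV V N"
  unfolding dual_def linear_on_def by (auto intro!: exI[of _ 0])

lemma dual_norm_bdd_above:
  assumes "\<phi> \<in> dual sV V N" "\<And>v. v \<in> V \<Longrightarrow> 0 \<le> N v"
  shows "bdd_above ((\<lambda>v. norm (\<phi> v)) ` {v \<in> V. N v \<le> 1})"
proof -
  obtain B where B: "\<forall>v\<in>V. norm (\<phi> v) \<le> B * N v"
    using assms unfolding dual_def by blast
  show ?thesis
  proof (rule bdd_aboveI2)
    fix v assume v: "v \<in> {v \<in> V. N v \<le> 1}"
    then have "norm (\<phi> v) \<le> B * N v" using B by blast
    also have "\<dots> \<le> \<bar>B\<bar> * 1"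
      using v assms(2)[of v] by (intro mult_mono) auto
    finally show "norm (\<phi> v) \<le> \<bar>B\<bar>" by simp
  qed
qed

lemma dual_norm_nonneg:
  assumes "\<phi> \<in> dual sV V N" "v \<in> V" "N v \<le> 1" "\<And>v. v \<in> V \<Longrightarrow> 0 \<le> N v"
  shows "0 \<le> dual_norm V N \<phi>"
proof -
  have "norm (\<phi> v) \<le> dual_norm V N \<phi>"
    unfolding dual_norm_def using dual_norm_bdd_above[OF assms(1,4)] assms(2,3)
    by (intro cSUP_upper) auto
  then show ?thesis using norm_ge_zero order_trans by blast
qed

section \<open>Cluster points of bounded nets\<close>

text \<open>By Tychonoff's theorem, a pointwise bounded net of functions has a point that inherits all closed
  properties which hold eventually along the net.  This replaces a limit along an ultrafilter.\<close>

lemma bounded_net_cluster_point: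
  fixes t :: "'b \<Rightarrow> 'i \<Rightarrow> 'c::{heine_borel, real_normed_vector}"
  assumes F: "F \<noteq> bot" and bound: "\<And>B i. norm (t B i) \<le> R i"
  obtains g where "\<And>P. closed {h. P h} \<Longrightarrow> eventually (\<lambda>B. P (t B)) F \<Longrightarrow> P g"
proof -
  let ?U = "Pi\<^sub>E UNIV (\<lambda>i. cball (0::'c) (R i))"
  have "compactin (product_topology (\<lambda>i. euclidean) UNIV) ?U"
    by (subst compactin_PiE) auto
  then have "compact ?U"
    by (simp add: euclidean_product_topology)
  moreover have "filtermap t F \<noteq> bot" "eventually (\<lambda>h. h \<in> ?U) (filtermap t F)"
    using F bound by (auto simp: filtermap_bot_iff eventually_filtermap PiE_iff)
  ultimately obtain g where g: "inf (nhds g) (filtermap t F) \<noteq> bot"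
    unfolding compact_filter by blast
  show thesis
  proof (rule that)
    fix P :: "('i \<Rightarrow> 'c) \<Rightarrow> bool"
    assume closed: "closed {h. P h}" and ev: "eventually (\<lambda>B. P (t B)) F"
    show "P g"
    proof (rule ccontr)
      assume "\<not> P g"
      then have "eventually (\<lambda>h. \<not> P h) (nhds g)"
        using closed unfolding closed_def by (auto simp: eventually_nhds Collect_neg_eq intro!: exI[of _ "- {h. P h}"])
      moreover have "eventually P (filtermap t F)"
        using ev by (simp add: eventually_filtermap)
      ultimately have "eventually (\<lambda>h. False) (inf (nhds g) (filtermap t F))"
        unfolding eventually_inf by blast
      then show False using g by (simp add: eventually_False)
    qed
  qed
qed

section \<open>Locally trivial maps into spaces complemented in their bidual\<close>

context quasi_linear_map
begin

lemma ydual_linear: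
  assumes "\<phi> \<in> ydual sY"
  shows "\<phi> (y + z) = \<phi> y + \<phi> z" and "\<phi> (sY c y) = c * \<phi> y"
  using assms by (auto simp: ydual_def dual_def linear_on_def)

lemma ydual_bound:
  assumes \<phi>: "\<phi> \<in> ydual sY"
  shows "norm (\<phi> y) \<le> dual_norm UNIV norm \<phi> * norm y"
proof (cases "y = 0")
  case True
  then show ?thesis using ydual_linear(2)[OF \<phi>, of 0 0] by simp
next
  case False
  let ?z = "sY (of_real (inverse (norm y))) y"
  have "norm ?z \<le> 1" using False by (simp add: norm_sY norm_inverse)
  then have "norm (\<phi> ?z) \<le> dual_norm UNIV norm \<phi>"
    unfolding dual_norm_def using dual_norm_bdd_above[OF \<phi>[unfolded ydual_def]]
    by (intro cSUP_upper) auto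
  moreover have "norm (\<phi> ?z) = norm (\<phi> y) / norm y"
    using False by (simp add: ydual_linear(2)[OF \<phi>] norm_mult norm_inverse divide_inverse mult.commute del: of_real_inverse)
  ultimately have "norm (\<phi> y) / norm y \<le> dual_norm UNIV norm \<phi>" by simp
  then show ?thesis using False by (simp add: pos_divide_le_eq)
qed

lemma ydual_norm_nonneg: "\<phi> \<in> ydual sY \<Longrightarrow> 0 \<le> dual_norm UNIV norm \<phi>"
  unfolding ydual_def by (rule dual_norm_nonneg[where v = 0]) auto

lemma ydual_add: "\<phi> \<in> ydual sY \<Longrightarrow> \<psi> \<in> ydual sY \<Longrightarrow> \<phi> + \<psi> \<in> ydual sY"
  unfolding ydual_def by (rule dual_add)

lemma ydual_scale: "\<phi> \<in> ydual sY \<Longrightarrow> fscale c \<phi> \<in> ydual sY"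
  unfolding ydual_def by (rule dual_scale)

lemma zero_in_ydual: "0 \<in> ydual sY"
  unfolding ydual_def by (rule zero_in_dual)

lemma zero_dual_norm: "dual_norm UNIV norm (0 :: 'y \<Rightarrow> 'k) = 0"
proof -
  have "(0::'y) \<in> {v \<in> UNIV. norm v \<le> 1}" by simp
  then have "{v \<in> UNIV. norm (v::'y) \<le> 1} \<noteq> {}" by blast
  then show ?thesis by (simp add: dual_norm_def)
qed

lemma bidual_norm_nonneg: "\<Psi> \<in> bidual sY \<Longrightarrow> 0 \<le> bidual_norm sY \<Psi>"
  unfolding bidual_def bidual_norm_def
  by (rule dual_norm_nonneg[OF _ zero_in_ydual])
    (simp_all add: zero_dual_norm ydual_norm_nonneg del: zero_fun_apply)

lemma canonical_embedding_in_bidual: "canonical_embedding sY y \<in> bidual sY"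
proof -
  have "norm (canonical_embedding sY y \<phi>) \<le> norm y * dual_norm UNIV norm \<phi>"
    if "\<phi> \<in> ydual sY" for \<phi>
    using ydual_bound[OF that] that by (simp add: canonical_embedding_def mult.commute)
  then show ?thesis
    unfolding bidual_def dual_def linear_on_def canonical_embedding_def
    by (auto simp: ydual_add ydual_scale fscale_apply)
qed

lemma bidual_norm_le:
  assumes "0 \<le> C" "\<And>\<phi>. \<phi> \<in> ydual sY \<Longrightarrow> norm (\<Psi> \<phi>) \<le> C * dual_norm UNIV norm \<phi>"
  shows "bidual_norm sY \<Psi> \<le> C"
  unfolding bidual_norm_def dual_norm_def[of "ydual sY"]
proof (rule cSUP_least)
  show "{\<phi> \<in> ydual sY. dual_norm UNIV norm \<phi> \<le> 1} \<noteq> {}"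
    using zero_in_ydual zero_dual_norm by force
next
  fix \<phi> assume \<phi>: "\<phi> \<in> {\<phi> \<in> ydual sY. dual_norm UNIV norm \<phi> \<le> 1}"
  then have "norm (\<Psi> \<phi>) \<le> C * dual_norm UNIV norm \<phi>" using assms(2) by blast
  also have "\<dots> \<le> C * 1" using \<phi> assms(1) by (intro mult_left_mono) auto
  finally show "norm (\<Psi> \<phi>) \<le> C" by simp
qed

text \<open>The map \<open>\<Lambda>\<close> is a pointwise weak-\<open>*\<close> cluster point of the net of linear maps on finite-dimensional
  subspaces.  For each \<open>f\<close>, linearity and the distance from \<open>\<Omega>\<close> are closed conditions on values
  of the functionals, and they hold eventually along the net.\<close>

lemma linear_map_into_bidual:
  assumes "locally_trivial K N sY \<Omega>"
  obtains \<Lambda> C where "linear_on fscale K fscale \<Lambda>" and "0 \<le> C"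
    and "\<And>f. f \<in> K \<Longrightarrow> \<Lambda> f - canonical_embedding sY (\<Omega> f) \<in> bidual sY"
    and "\<And>f. f \<in> K \<Longrightarrow> bidual_norm sY (\<Lambda> f - canonical_embedding sY (\<Omega> f)) \<le> C * N f"
proof -
  obtain C where "C > 0" and ex: "\<And>B. finite B \<Longrightarrow> B \<subseteq> K \<Longrightarrow>
      \<exists>L. linear_on fscale (fvec.span B) sY L \<and> hom_dist (fvec.span B) N \<Omega> L \<le> ereal C"
    using assms unfolding locally_trivial_def by blast
  have "\<exists>L. linear_on fscale (fvec.span B) sY L \<and>
      (\<forall>f\<in>fvec.span B. norm (\<Omega> f - L f) \<le> C * N f)" if "finite B" "B \<subseteq> K" for B
    using ex[OF that] hom_dist_le_iff[OF fvec.subspace_span span_subset_K[OF that(2)]] \<open>C > 0\<close>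
    by (meson less_imp_le)
  then obtain L where lin: "\<And>B. finite B \<Longrightarrow> B \<subseteq> K \<Longrightarrow> linear_on fscale (fvec.span B) sY (L B)"
    and bound: "\<And>B f. finite B \<Longrightarrow> B \<subseteq> K \<Longrightarrow> f \<in> fvec.span B \<Longrightarrow> norm (\<Omega> f - L B f) \<le> C * N f"
    by metis
  \<comment> \<open>The net of linear maps is read as a net of scalar functions of pairs \<open>(f, \<phi>)\<close>.  Each pair
    has its value \<open>\<phi> (L B f)\<close> as soon as \<open>B\<close> contains \<open>f\<close>, and the default value 0 before.\<close>
  let ?F = "finite_subsets_at_top K"
  define t where "t B = (\<lambda>(f, \<phi>). if finite B \<and> B \<subseteq> K \<and> f \<in> fvec.span B \<and> \<phi> \<in> ydual sY
      then \<phi> (L B f) else 0)" for B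
  define R where "R = (\<lambda>(f, \<phi> :: 'y \<Rightarrow> 'k). \<bar>dual_norm UNIV norm \<phi>\<bar> * \<bar>norm (\<Omega> f) + C * N f\<bar>)"
  have t: "t B (f, \<phi>) = \<phi> (L B f)"
    if "finite B" "B \<subseteq> K" "f \<in> fvec.span B" "\<phi> \<in> ydual sY" for B f \<phi>
    using that by (simp add: t_def)
  have t_bound: "norm (t B i) \<le> R i" for B i
  proof (cases i)
    case i: (Pair f \<phi>)
    show ?thesis
    proof (cases "finite B \<and> B \<subseteq> K \<and> f \<in> fvec.span B \<and> \<phi> \<in> ydual sY")
      case True
      then have "norm (L B f) \<le> norm (\<Omega> f) + C * N f"
        using bound[of B f] norm_triangle_ineq4[of "\<Omega> f" "\<Omega> f - L B f"] by simp
      then have "norm (\<phi> (L B f)) \<le> \<bar>dual_norm UNIV norm \<phi>\<bar> * \<bar>norm (\<Omega> f) + C * N f\<bar>"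
        using ydual_bound[of \<phi> "L B f"] True
        by (intro order_trans[OF ydual_bound] mult_mono) auto
      then show ?thesis using True i by (simp add: t_def R_def)
    next
      case False
      then have "t B i = 0" by (simp only: t_def i split_conv if_False)
      then show ?thesis by (simp add: R_def i)
    qed
  qed
  obtain g where g: "\<And>P. closed {h. P h} \<Longrightarrow> eventually (\<lambda>B. P (t B)) ?F \<Longrightarrow> P g"
    using bounded_net_cluster_point[of ?F t R, OF finite_subsets_at_top_neq_bot t_bound] by blast
  have ev: "eventually P ?F"
    if "finite A" "A \<subseteq> K" "\<And>B. finite B \<Longrightarrow> B \<subseteq> K \<Longrightarrow> A \<subseteq> fvec.span B \<Longrightarrow> P B" for P A
    unfolding eventually_finite_subsets_at_top
    using that by (intro exI[of _ A]) (auto intro: fvec.span_base)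
  have g_add: "g (f + h, \<phi>) = g (f, \<phi>) + g (h, \<phi>)"
    if "f \<in> K" "h \<in> K" "\<phi> \<in> ydual sY" for f h \<phi>
  proof (rule g[of "\<lambda>g. g (f + h, \<phi>) = g (f, \<phi>) + g (h, \<phi>)"])
    show "eventually (\<lambda>B. t B (f + h, \<phi>) = t B (f, \<phi>) + t B (h, \<phi>)) ?F"
    proof (rule ev[of "{f, h}"])
      fix B assume B: "finite B" "B \<subseteq> K" "{f, h} \<subseteq> fvec.span B"
      then have "f + h \<in> fvec.span B" "L B (f + h) = L B f + L B h"
        using lin[of B] by (auto intro: fvec.span_add simp: linear_on_def simp del: plus_fun_apply)
      then show "t B (f + h, \<phi>) = t B (f, \<phi>) + t B (h, \<phi>)"
        using B that ydual_linear(1)[OF that(3)] by (simp add: t del: plus_fun_apply)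
    qed (use that in auto)
  qed (intro closed_Collect_eq continuous_intros continuous_on_product_coordinates)
  have g_scale: "g (fscale c f, \<phi>) = c * g (f, \<phi>)" if "f \<in> K" "\<phi> \<in> ydual sY" for f c \<phi>
  proof (rule g[of "\<lambda>g. g (fscale c f, \<phi>) = c * g (f, \<phi>)"])
    show "eventually (\<lambda>B. t B (fscale c f, \<phi>) = c * t B (f, \<phi>)) ?F"
    proof (rule ev[of "{f}"])
      fix B assume B: "finite B" "B \<subseteq> K" "{f} \<subseteq> fvec.span B"
      then have "fscale c f \<in> fvec.span B" "L B (fscale c f) = sY c (L B f)"
        using lin[of B] by (auto intro: fvec.span_scale simp: linear_on_def)
      then show "t B (fscale c f, \<phi>) = c * t B (f, \<phi>)"
        using B that ydual_linear(2)[OF that(2)] by (simp add: t)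
    qed (use that in auto)
  qed (intro closed_Collect_eq continuous_intros continuous_on_product_coordinates)
  have g_dual_add: "g (f, \<phi> + \<psi>) = g (f, \<phi>) + g (f, \<psi>)"
    if "f \<in> K" "\<phi> \<in> ydual sY" "\<psi> \<in> ydual sY" for f \<phi> \<psi>
  proof (rule g[of "\<lambda>g. g (f, \<phi> + \<psi>) = g (f, \<phi>) + g (f, \<psi>)"])
    have "\<phi> + \<psi> \<in> ydual sY" using that ydual_add by blast
    then show "eventually (\<lambda>B. t B (f, \<phi> + \<psi>) = t B (f, \<phi>) + t B (f, \<psi>)) ?F"
      using that by (intro ev[of "{f}"]) (auto simp: t)
  qed (intro closed_Collect_eq continuous_intros continuous_on_product_coordinates)
  have g_dual_scale: "g (f, fscale c \<phi>) = c * g (f, \<phi>)" if "f \<in> K" "\<phi> \<in> ydual sY" for f c \<phi>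
  proof (rule g[of "\<lambda>g. g (f, fscale c \<phi>) = c * g (f, \<phi>)"])
    have "fscale c \<phi> \<in> ydual sY" using that ydual_scale by blast
    then show "eventually (\<lambda>B. t B (f, fscale c \<phi>) = c * t B (f, \<phi>)) ?F"
      using that by (intro ev[of "{f}"]) (auto simp: t fscale_apply)
  qed (intro closed_Collect_eq continuous_intros continuous_on_product_coordinates)
  have g_zero: "g (f, \<phi>) = 0" if "\<phi> \<notin> ydual sY" for f \<phi>
    by (rule g[of "\<lambda>g. g (f, \<phi>) = 0"])
      (use that in \<open>auto simp: t_def intro!: closed_Collect_eq continuous_intros continuous_on_product_coordinates\<close>)
  have g_bound: "norm (g (f, \<phi>) - \<phi> (\<Omega> f)) \<le> C * N f * dual_norm UNIV norm \<phi>"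
    if "f \<in> K" and \<phi>: "\<phi> \<in> ydual sY" for f \<phi>
  proof (rule g[of "\<lambda>g. norm (g (f, \<phi>) - \<phi> (\<Omega> f)) \<le> C * N f * dual_norm UNIV norm \<phi>"])
    show "eventually (\<lambda>B. norm (t B (f, \<phi>) - \<phi> (\<Omega> f)) \<le> C * N f * dual_norm UNIV norm \<phi>) ?F"
    proof (rule ev[of "{f}"])
      fix B assume B: "finite B" "B \<subseteq> K" "{f} \<subseteq> fvec.span B"
      have "\<phi> (\<Omega> f) = \<phi> (L B f) + \<phi> (\<Omega> f - L B f)"
        using ydual_linear(1)[OF \<phi>, of "L B f" "\<Omega> f - L B f"] by simp
      then have "norm (t B (f, \<phi>) - \<phi> (\<Omega> f)) = norm (\<phi> (\<Omega> f - L B f))"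
        using B \<phi> by (simp add: t)
      also have "\<dots> \<le> dual_norm UNIV norm \<phi> * norm (\<Omega> f - L B f)"
        by (rule ydual_bound[OF \<phi>])
      also have "\<dots> \<le> dual_norm UNIV norm \<phi> * (C * N f)"
        using bound[of B f] B ydual_norm_nonneg[OF \<phi>] by (intro mult_left_mono) auto
      finally show "norm (t B (f, \<phi>) - \<phi> (\<Omega> f)) \<le> C * N f * dual_norm UNIV norm \<phi>"
        by (simp add: mult.commute)
    qed (use that in auto)
  qed (intro closed_Collect_le continuous_intros continuous_on_product_coordinates)
  define \<Lambda> where "\<Lambda> f \<phi> = g (f, \<phi>)" for f \<phi>
  let ?J = "canonical_embedding sY"
  have diff: "(\<Lambda> f - ?J (\<Omega> f)) \<phi> = (if \<phi> \<in> ydual sY then g (f, \<phi>) - \<phi> (\<Omega> f) else 0)" for f \<phi>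
    by (simp add: \<Lambda>_def canonical_embedding_def g_zero)
  show thesis
  proof (rule that)
    show "linear_on fscale K fscale \<Lambda>"
      unfolding linear_on_def
    proof (intro conjI ballI allI ext)
      fix f h \<phi> assume "f \<in> K" "h \<in> K"
      then show "\<Lambda> (f + h) \<phi> = (\<Lambda> f + \<Lambda> h) \<phi>"
        using g_add[of f h \<phi>] by (cases "\<phi> \<in> ydual sY") (simp_all add: \<Lambda>_def g_zero)
    next
      fix c f \<phi> assume "f \<in> K"
      then show "\<Lambda> (fscale c f) \<phi> = fscale c (\<Lambda> f) \<phi>"
        using g_scale[of f \<phi>] by (cases "\<phi> \<in> ydual sY") (simp_all add: \<Lambda>_def g_zero fscale_apply)
    qed
    show "0 \<le> C" using \<open>C > 0\<close> by simp
    fix f assume f: "f \<in> K"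
    have bd: "norm ((\<Lambda> f - ?J (\<Omega> f)) \<phi>) \<le> C * N f * dual_norm UNIV norm \<phi>" if "\<phi> \<in> ydual sY" for \<phi>
      using g_bound[OF f that] that diff by simp
    show "\<Lambda> f - ?J (\<Omega> f) \<in> bidual sY"
      unfolding bidual_def dual_def linear_on_def mem_Collect_eq
    proof (intro conjI ballI allI)
      fix \<phi> \<psi> assume 2: "\<phi> \<in> ydual sY" "\<psi> \<in> ydual sY"
      then have "\<phi> + \<psi> \<in> ydual sY" using ydual_add by blast
      with 2 show "(\<Lambda> f - ?J (\<Omega> f)) (\<phi> + \<psi>) = (\<Lambda> f - ?J (\<Omega> f)) \<phi> + (\<Lambda> f - ?J (\<Omega> f)) \<psi>"
        unfolding diff using g_dual_add[OF f] by simp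
    next
      fix c \<phi> assume \<phi>: "\<phi> \<in> ydual sY"
      then have "fscale c \<phi> \<in> ydual sY" using ydual_scale by blast
      with \<phi> show "(\<Lambda> f - ?J (\<Omega> f)) (fscale c \<phi>) = c * (\<Lambda> f - ?J (\<Omega> f)) \<phi>"
        unfolding diff using g_dual_scale[OF f] by (simp add: fscale_apply algebra_simps)
    next
      show "\<exists>B. \<forall>\<phi>\<in>ydual sY. norm ((\<Lambda> f - ?J (\<Omega> f)) \<phi>) \<le> B * dual_norm UNIV norm \<phi>"
        using bd by blast
    next
      fix \<phi>
      show "\<phi> \<notin> ydual sY \<longrightarrow> (\<Lambda> f - ?J (\<Omega> f)) \<phi> = 0"
        unfolding diff by simp
    qed
    show "bidual_norm sY (\<Lambda> f - ?J (\<Omega> f)) \<le> C * N f"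
      using \<open>C > 0\<close> N_nonneg[OF f] by (intro bidual_norm_le bd) auto
  qed
qed

text \<open>The projection is applied to \<open>\<Lambda>\<close>.  It fixes the values of \<open>\<Omega>\<close>, so that only the bounded
  difference of the two maps contributes to the distance.\<close>

lemma locally_trivial_imp_trivial:
  assumes compl: "complemented_in_bidual sY" and loc: "locally_trivial K N sY \<Omega>"
  shows "trivial_on K N sY \<Omega>"
proof -
  let ?J = "canonical_embedding sY"
  obtain P b where P: "linear_on fscale (bidual sY) sY P"
    and b: "\<And>\<Psi>. \<Psi> \<in> bidual sY \<Longrightarrow> norm (P \<Psi>) \<le> b * bidual_norm sY \<Psi>"
    and P_J: "\<And>y. P (?J y) = y"
    using compl unfolding complemented_in_bidual_def by blast
  obtain \<Lambda> C where \<Lambda>: "linear_on fscale K fscale \<Lambda>" and C: "0 \<le> C"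
    and D: "\<And>f. f \<in> K \<Longrightarrow> \<Lambda> f - ?J (\<Omega> f) \<in> bidual sY"
      "\<And>f. f \<in> K \<Longrightarrow> bidual_norm sY (\<Lambda> f - ?J (\<Omega> f)) \<le> C * N f"
    using linear_map_into_bidual[OF loc] by metis
  have \<Lambda>_bidual: "\<Lambda> f \<in> bidual sY" if "f \<in> K" for f
  proof -
    have "?J (\<Omega> f) + (\<Lambda> f - ?J (\<Omega> f)) \<in> bidual sY"
      using canonical_embedding_in_bidual D(1)[OF that] unfolding bidual_def by (rule dual_add)
    then show ?thesis by simp
  qed
  have "linear_on fscale K sY (\<lambda>f. P (\<Lambda> f))"
    using P \<Lambda> \<Lambda>_bidual unfolding linear_on_def by simp
  moreover have "norm (\<Omega> f - P (\<Lambda> f)) \<le> (\<bar>b\<bar> * C) * N f" if f: "f \<in> K" for f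
  proof -
    let ?D = "\<Lambda> f - ?J (\<Omega> f)"
    have "P (?J (\<Omega> f) + ?D) = P (?J (\<Omega> f)) + P ?D"
      using P canonical_embedding_in_bidual D(1)[OF f] unfolding linear_on_def by blast
    then have "P (\<Lambda> f) = \<Omega> f + P ?D" by (simp add: P_J)
    then have "norm (\<Omega> f - P (\<Lambda> f)) = norm (P ?D)" by simp
    also have "\<dots> \<le> b * bidual_norm sY ?D" by (rule b[OF D(1)[OF f]])
    also have "\<dots> \<le> \<bar>b\<bar> * (C * N f)"
      using D[OF f] bidual_norm_nonneg by (intro mult_mono) auto
    finally show ?thesis by (simp add: mult.assoc)
  qed
  ultimately show ?thesis
    using C unfolding trivial_on_iff[OF K_subspace order_refl]
    by (intro exI[of _ "\<lambda>f. P (\<Lambda> f)"] exI[of _ "\<bar>b\<bar> * C"]) auto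
qed

end

section \<open>Equivalence of the notions of triviality\<close>

theorem proposition3p2:
  fixes M :: "'a measure"
    and K :: "('a \<Rightarrow> 'k::{real_normed_field, euclidean_space}) set"
    and N :: "('a \<Rightarrow> 'k) \<Rightarrow> real"
    and sY :: "'k \<Rightarrow> 'y::banach \<Rightarrow> 'y"
    and \<Omega> :: "('a \<Rightarrow> 'k) \<Rightarrow> 'y"
  assumes "sigma_finite_measure M"
    and "koethe_space M K N"
    and "banach_over sY"
    and "quasi_linear M K N sY \<Omega>"
  shows "(trivial_on K N sY \<Omega> \<longrightarrow> disjointly_trivial M K N sY \<Omega>) \<and>
         (disjointly_trivial M K N sY \<Omega> \<longrightarrow> locally_disjointly_trivial M K N sY \<Omega>) \<and>
         (locally_disjointly_trivial M K N sY \<Omega> \<longleftrightarrow> locally_trivial K N sY \<Omega>) \<and>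
         (complemented_in_bidual sY \<longrightarrow>
            (trivial_on K N sY \<Omega> \<longleftrightarrow> disjointly_trivial M K N sY \<Omega>) \<and>
            (trivial_on K N sY \<Omega> \<longleftrightarrow> locally_disjointly_trivial M K N sY \<Omega>) \<and>
            (trivial_on K N sY \<Omega> \<longleftrightarrow> locally_trivial K N sY \<Omega>))"
proof -
  obtain Q where Q: "\<forall>f\<in>K. \<forall>g\<in>K. N (f + g) \<le> Q * (N f + N g)" and N: "\<forall>f\<in>K. 0 \<le> N f"
    using assms(2) unfolding koethe_space_def quasi_norm_on_def by blast
  obtain Z where Z: "\<forall>f\<in>K. \<forall>g\<in>K. norm (\<Omega> (f + g) - \<Omega> f - \<Omega> g) \<le> Z * (N f + N g)"
    using assms(4) unfolding quasi_linear_def by blast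
  have "N (f + g) \<le> max Q 1 * (N f + N g)"
    and "norm (\<Omega> (f + g) - \<Omega> f - \<Omega> g) \<le> max Z 0 * (N f + N g)" if fg: "f \<in> K" "g \<in> K" for f g
  proof -
    have "Q * (N f + N g) \<le> max Q 1 * (N f + N g)" "Z * (N f + N g) \<le> max Z 0 * (N f + N g)"
      using N fg by (auto intro!: mult_right_mono)
    then show "N (f + g) \<le> max Q 1 * (N f + N g)"
      and "norm (\<Omega> (f + g) - \<Omega> f - \<Omega> g) \<le> max Z 0 * (N f + N g)"
      using Q Z fg order_trans by blast+
  qed
  then interpret quasi_linear_map M K N sY \<Omega> "max Q 1" "max Z 0"
    using assms(2-4) by unfold_locales simp_all
  show ?thesis
    using trivial_imp_disjointly_trivial disjointly_trivial_imp_locally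
      locally_disjointly_trivial_imp_locally_trivial locally_trivial_imp_locally_disjointly_trivial
      locally_trivial_imp_trivial
    by blast
qed

end
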